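(* Let $n\ge 2$, $a,b>-1$ and $\beta>0$. Let $(\lambda_1,\dots,\lambda_n)$ be a random vector with the Jacobi ensemble density $$f(\lambda)=c\prod_{i<j}|\lambda_i-\lambda_j|^{\beta}\prod_{i=1}^n(2-\lambda_i)^a(2+\lambda_i)^b\,I_{(-2,2)}(\lambda_i),$$ where $c$ is the normalizing constant, and let $\lambda_1^{(n)}\le\dots\le\lambda_n^{(n)}$ denote its order statistics (the ordered eigenvalues). Let $x_1^{(n)}<\dots<x_n^{(n)}$ denote the ordered roots of the polynomial $x\mapsto P_n^{(\frac{2a+2}{\beta}-1,\frac{2b+2}{\beta}-1)}(\tfrac12 x)$. Then for every $\varepsilon\in(0,1]$, $$P\Big(\max_{1\le j\le n}|\lambda_j^{(n)}-x_j^{(n)}|>\varepsilon\Big)\le 4(2n-1)\exp\Big\{\Big(\log\Big(1+\frac{\varepsilon^2}{648+2\varepsilon^2}\Big)-\frac{\varepsilon^2}{648+2\varepsilon^2}\Big)(a+b+2)\Big\}.$$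
   Context: For $\gamma,\delta>-1$, $P_n^{(\gamma,\delta)}$ denotes the Jacobi polynomial of degree $n$: the polynomial of degree $n$ with leading coefficient $(n+\gamma+\delta+1)_n/(2^n n!)$ such that $\int_{-1}^1P_n^{(\gamma,\delta)}(x)P_m^{(\gamma,\delta)}(x)(1-x)^\gamma(1+x)^\delta\,dx=0$ for $m\ne n$. Here $(a)_n=\Gamma(a+n)/\Gamma(a)$ is the Pochhammer symbol. *)

theory Defs
  imports "HOL-Probability.Probability" "HOL-Computational_Algebra.Polynomial"
begin

definition jacobi_weight :: "real \<Rightarrow> real \<Rightarrow> real \<Rightarrow> real" where
  "jacobi_weight g d x = (1 - x) powr g * (1 + x) powr d"

definition jacobi_poly :: "real \<Rightarrow> real \<Rightarrow> nat \<Rightarrow> real poly" where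
  "jacobi_poly g d = (THE P. (\<forall>k. degree (P k) = k \<and>
        lead_coeff (P k) = pochhammer (real k + g + d + 1) k / (2 ^ k * fact k)) \<and>
      (\<forall>k m. k \<noteq> m \<longrightarrow>
        integral {-1..1} (\<lambda>x. poly (P k) x * poly (P m) x * jacobi_weight g d x) = 0))"

definition jacobi_scaled_roots :: "real \<Rightarrow> real \<Rightarrow> nat \<Rightarrow> real list" where
  "jacobi_scaled_roots g d n = sorted_list_of_set {x. poly (jacobi_poly g d n) (x / 2) = 0}"

definition jacobi_ens_weight :: "nat \<Rightarrow> real \<Rightarrow> real \<Rightarrow> real \<Rightarrow> (nat \<Rightarrow> real) \<Rightarrow> real" where
  "jacobi_ens_weight n a b \<beta> l =
     (\<Prod>i<n. \<Prod>j\<in>{i<..<n}. \<bar>l i - l j\<bar> powr \<beta>) *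
     (\<Prod>i<n. (2 - l i) powr a * (2 + l i) powr b * indicator {-2<..<2} (l i))"

definition jacobi_ensemble :: "nat \<Rightarrow> real \<Rightarrow> real \<Rightarrow> real \<Rightarrow> (nat \<Rightarrow> real) measure" where
  "jacobi_ensemble n a b \<beta> =
     (let M = PiM {..<n} (\<lambda>_. lborel);
          Z = (\<integral>\<^sup>+ l. ennreal (jacobi_ens_weight n a b \<beta> l) \<partial>M)
      in density M (\<lambda>l. ennreal (jacobi_ens_weight n a b \<beta> l) / Z))"

definition order_stat :: "nat \<Rightarrow> (nat \<Rightarrow> real) \<Rightarrow> nat \<Rightarrow> real" where
  "order_stat n l j = sort (map l [0..<n]) ! j"

end

theory Submission
  imports Defs
begin

text \<open>
  By the Stieltjes relation, the scaled zeros \<open>x\<^sub>i\<close> of the Jacobi polynomial are the equilibrium of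
  the vector field whose \<open>i\<close>-th component is
  \<open>\<beta> (\<Sum>j\<noteq>i. 1 / (\<lambda>\<^sub>i - \<lambda>\<^sub>j)) - (a + 1) / (2 - \<lambda>\<^sub>i) + (b + 1) / (2 + \<lambda>\<^sub>i)\<close>.
  Integrating by parts against \<open>(4 - \<lambda>\<^sub>i\<^sup>2) \<phi>(\<lambda>\<^sub>i - x\<^sub>i)\<close> with \<open>\<phi>\<close> increasing, the repulsion between
  two particles has the favourable sign after comparison with the translated configuration
  \<open>x + r\<close> (for all \<open>r\<close> at once, weighted by \<open>\<phi>'(r)\<close>), because \<open>(4 - u v) / (u - v)\<close> is monotone in each
  variable. Only the confining force remains; it is of order \<open>a + b + 2\<close> whatever \<open>n\<close> and \<open>\<beta>\<close> are.
  For \<open>\<phi>\<close> a power of the positive part this bounds a high moment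
  of the deviations, summed over the particles, and Markov's inequality concludes.
\<close>

subsection \<open>The drift inequality\<close>

text \<open>With \<open>u = 2 * tanh s\<close> and \<open>v = 2 * tanh t\<close> the kernel
  \<open>(4 - u * v) / (u - v)\<close> is \<open>2 * coth (s - t)\<close>, which explains its
  monotonicity. The factor \<open>4 - (l i)\<^sup>2\<close> is what produces this kernel; it also
  removes the boundary terms at -2 and 2, where the density blows up if \<open>a\<close> or
  \<open>b\<close> is negative. A complication runs through the whole proof: the target of a
  particle depends on its rank, so the test function is a family indexed by ranks. After integration
  the derivative of the test function, \<open>(4 - (l i)\<^sup>2) * Y ^ m\<close> with
  \<open>m = 2 * k\<close>, competes with a damping of order
  \<open>(a + b + 2) * (4 - (l i)\<^sup>2) * Y ^ (m+2) / m\<close>. It can win only while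
  \<open>Y\<^sup>2\<close> is at most of order \<open>k / (a + b + 2)\<close>, so the moment of
  order \<open>2 * k + 2\<close> is controlled by powers of \<open>k / (a + b + 2)\<close>, and a
  \<open>k\<close> of order \<open>(a + b + 2) * \<epsilon>\<^sup>2\<close> makes Markov's bound
  exponentially small.\<close>

lemma coth_kernel_mono:
  fixes u v h k :: real
  assumes "\<bar>u\<bar> < 2" "\<bar>v\<bar> < 2" "-2 < h" "h \<le> u" "v \<le> k" "(u - v) * (h - k) > 0"
  shows "(4 - u * v) / (u - v) \<le> (4 - h * k) / (h - k)"
proof -
  have *: "(4 - h * k) / (h - k) - (4 - u * v) / (u - v)
      = ((k - v) * (4 - u\<^sup>2) + (u - h) * (4 - v\<^sup>2) + (u - h) * (k - v) * (u - v)) / ((u - v) * (h - k))"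
    using assms(6) by (simp add: divide_simps) (auto simp: algebra_simps power2_eq_square)
  have sq: "0 \<le> 4 - v\<^sup>2" "4 - u\<^sup>2 = (2 - u) * (2 + u)"
    using assms abs_le_square_iff[of v 2] by (auto simp: algebra_simps power2_eq_square)
  \<comment> \<open>The point \<open>k\<close> may exceed 2, so both pairs cannot be assumed to lie
    in the interval. The last term of the numerator is nonpositive for \<open>u \<le> v\<close>;
    since \<open>u - h \<le> 2 + u\<close> and \<open>v - u \<le> 2 - u\<close>, the first term
    absorbs it.\<close>
  have "(u - h) * (v - u) \<le> (2 + u) * (2 - u)"
  proof (cases "u \<le> v")
    case True
    thus ?thesis using assms by (intro mult_mono') (auto simp: abs_less_iff)
  next
    case False
    hence "(u - h) * (v - u) \<le> 0" using assms by (intro mult_nonneg_nonpos) auto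
    also have "0 \<le> (2 + u) * (2 - u)" using assms by (intro mult_nonneg_nonneg) auto
    finally show ?thesis .
  qed
  hence "0 \<le> (k - v) * ((2 + u) * (2 - u) - (u - h) * (v - u))"
    using assms by (intro mult_nonneg_nonneg) auto
  moreover have "0 \<le> (u - h) * (4 - v\<^sup>2)"
    using assms sq by (intro mult_nonneg_nonneg) auto
  ultimately have "0 \<le> (k - v) * (4 - u\<^sup>2) + (u - h) * (4 - v\<^sup>2) + (u - h) * (k - v) * (u - v)"
    unfolding sq(2) by (simp add: algebra_simps)
  thus ?thesis using * assms(6) by (smt (verit) divide_nonneg_pos)
qed

text \<open>\<open>Q\<close> is the primitive of \<open>r ^ m * (4 - (x + r) * (y + r))\<close> that
  vanishes at 0. For \<open>r\<close> between \<open>t\<close> and \<open>s\<close> one has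
  \<open>x + r \<le> u\<close> and \<open>v \<le> y + r\<close>, so \<open>w\<close> is at most the
  kernel of the pair translated by \<open>r\<close>, whose denominator is \<open>x - y\<close> for
  every \<open>r\<close>. Integrating this against \<open>r ^ m\<close> from \<open>t\<close> to
  \<open>s\<close> gives the bound.\<close>

lemma pair_drift_le:
  fixes u v x y :: real and m :: nat
  defines "w \<equiv> (4 - u * v) / (u - v)"
  defines "Q \<equiv> \<lambda>r. (4 - x * y) * (r ^ (m+1) / real (m+1)) - (x + y) * (r ^ (m+2) / real (m+2)) - r ^ (m+3) / real (m+3)"
  defines "s \<equiv> max (u - x) 0" and "t \<equiv> max (v - y) 0"
  assumes "\<bar>u\<bar> < 2" "\<bar>v\<bar> < 2" "\<bar>x\<bar> < 2" "\<bar>y\<bar> < 2" "(u - v) * (x - y) > 0" "t \<le> s"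
  shows "(s ^ (m+1) / real (m+1) - t ^ (m+1) / real (m+1)) * w \<le> (Q s - Q t) / (x - y)"
proof -
  have ne: "x \<noteq> y" using assms by auto
  define H where "H = (\<lambda>r. r ^ (m+1) / real (m+1) * w - Q r / (x - y))"
  have dp: "((\<lambda>r. r ^ Suc k / real (Suc k)) has_real_derivative r ^ k) (at r)" for k and r :: real
    using DERIV_cdivide[OF DERIV_pow[of "Suc k" r], of "real (Suc k)"] by (simp del: of_nat_Suc)
  note dp1 = dp[of m] and dp2 = dp[of "m+1"] and dp3 = dp[of "m+2"]
  have dQ: "(Q has_real_derivative (4 - x * y) * r ^ m - (x + y) * r ^ (m+1) - r ^ (m+2)) (at r)" for r
    using DERIV_diff[OF DERIV_diff[OF DERIV_cmult[OF dp1] DERIV_cmult[OF dp2]] dp3]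
    unfolding Q_def by (simp add: add.commute eval_nat_numeral)
  have dH: "(H has_real_derivative r ^ m * (w - (4 - (x + r) * (y + r)) / ((x + r) - (y + r)))) (at r)" for r
  proof -
    have "(H has_real_derivative r ^ m * w - ((4 - x * y) * r ^ m - (x + y) * r ^ (m+1) - r ^ (m+2)) / (x - y)) (at r)"
      using DERIV_diff[OF DERIV_cmult_right[OF dp1] DERIV_cdivide[OF dQ]] unfolding H_def by simp
    also have "(4 - x * y) * r ^ m - (x + y) * r ^ (m+1) - r ^ (m+2) = r ^ m * (4 - (x + r) * (y + r))"
      by (simp add: algebra_simps power_add power2_eq_square)
    finally show ?thesis by (simp add: algebra_simps)
  qed
  have "H s \<le> H t"
  proof (cases "s = t")
    case False
    hence st: "t < s" using assms by auto
    show ?thesis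
    proof (rule DERIV_nonpos_imp_nonincreasing[of t s H])
      fix r assume r: "t \<le> r" "r \<le> s"
      have "w \<le> (4 - (x + r) * (y + r)) / ((x + r) - (y + r))"
        unfolding w_def using assms r st by (intro coth_kernel_mono) (auto simp: abs_less_iff max_def split: if_splits)
      moreover have "0 \<le> r" using r assms by auto
      ultimately have "r ^ m * (w - (4 - (x + r) * (y + r)) / ((x + r) - (y + r))) \<le> 0"
        by (intro mult_nonneg_nonpos) auto
      with dH show "\<exists>z. (H has_real_derivative z) (at r) \<and> z \<le> 0" by blast
    qed (use st in auto)
  qed auto
  thus ?thesis unfolding H_def by (simp add: algebra_simps diff_divide_distrib)
qed

definition equilibrium :: "'a set \<Rightarrow> real \<Rightarrow> real \<Rightarrow> real \<Rightarrow> ('a \<Rightarrow> real) \<Rightarrow> bool" where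
  "equilibrium I \<beta> A B x \<longleftrightarrow>
     (\<forall>i\<in>I. \<bar>x i\<bar> < 2 \<and> \<beta> * (\<Sum>j\<in>I-{i}. 1 / (x i - x j)) = A / (2 - x i) - B / (2 + x i))"

text \<open>The force on particle \<open>i\<close> multiplied by \<open>4 - (l i)\<^sup>2\<close>;
  an \<open>equilibrium\<close> makes it vanish. \<open>A\<close> and \<open>B\<close> will be
  \<open>a + 1\<close> and \<open>b + 1\<close>, the shift by one coming from the derivative of the
  factor \<open>4 - u\<^sup>2\<close> in the integration by parts.\<close>

definition drift :: "'a set \<Rightarrow> real \<Rightarrow> real \<Rightarrow> real \<Rightarrow> ('a \<Rightarrow> real) \<Rightarrow> 'a \<Rightarrow> real" where
  "drift I \<beta> A B l i = \<beta> * (\<Sum>j\<in>I-{i}. (4 - (l i)\<^sup>2) / (l i - l j)) - A * (2 + l i) + B * (2 - l i)"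

text \<open>The kernel \<open>w\<close> is antisymmetric, so the repulsion can be averaged over both
  orders of each pair and compared by \<open>pair_drift_le\<close>; the equilibrium equation then
  eliminates the sums over \<open>x\<close>. The two terms on the right have different uses: the one
  with \<open>4 - (l i)\<^sup>2\<close> will absorb the derivative of the test function, the other
  bounds the moment itself. Neither \<open>\<beta>\<close> nor the number of particles survives,
  because their remaining contribution \<open>\<beta> * N * (p 2 y - y * p 1 y)\<close> is
  nonpositive.\<close>

lemma drift_one_sided:
  fixes l x :: "'a \<Rightarrow> real" and A B \<beta> :: real and m :: nat
  defines "Y \<equiv> \<lambda>i. max (l i - x i) 0"
  assumes I: "finite I" and A: "A > 0" and B: "B > 0" and \<beta>: "\<beta> > 0"
    and l: "\<And>i. i \<in> I \<Longrightarrow> \<bar>l i\<bar> < 2"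
    and x: "equilibrium I \<beta> A B x"
    and ord: "\<And>i j. i \<in> I \<Longrightarrow> j \<in> I \<Longrightarrow> i \<noteq> j \<Longrightarrow> (l i - l j) * (x i - x j) > 0"
  shows "(\<Sum>i\<in>I. Y i ^ (m+1) / real (m+1) * drift I \<beta> A B l i) \<le>
     - (\<Sum>i\<in>I. (A + B) * (4 - (l i)\<^sup>2) * Y i ^ (m+2) / (16 * real (m+3)) 
          + (A + B) * Y i ^ (m+2) / (real (m+1) * real (m+2)))"
proof -
  define w where "w = (\<lambda>i j. (4 - l i * l j) / (l i - l j))"
  define p where "p = (\<lambda>k r. r ^ (m+k) / real (m+k) :: real)"
  define Q where "Q = (\<lambda>i j r. (4 - x i * x j) * p 1 r - (x i + x j) * p 2 r - p 3 r)"
  define N where "N = real (card I) - 1"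
  have xb: "\<bar>x i\<bar> < 2" and xe: "\<beta> * (\<Sum>j\<in>I-{i}. 1 / (x i - x j)) = A / (2 - x i) - B / (2 + x i)"
    if "i \<in> I" for i using x that unfolding equilibrium_def by auto
  have cardN: "real (card (I - {i})) = N" if "i \<in> I" for i
    using that I unfolding N_def 
    by (metis card_Suc_Diff1 of_nat_Suc add_diff_cancel_left' add.commute)
  have Y0: "Y i \<ge> 0" for i unfolding Y_def by auto
  have drift: "drift I \<beta> A B l i = \<beta> * (\<Sum>j\<in>I-{i}. w i j) - \<beta> * N * l i - A * (2 + l i) + B * (2 - l i)"
    if i: "i \<in> I" for i
  proof -
    have "(\<Sum>j\<in>I-{i}. (4 - (l i)\<^sup>2) / (l i - l j)) = (\<Sum>j\<in>I-{i}. w i j - l i)"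
    proof (rule sum.cong)
      fix j assume "j \<in> I - {i}"
      hence "l i \<noteq> l j" using ord[of i j] i by auto
      thus "(4 - (l i)\<^sup>2) / (l i - l j) = w i j - l i"
        unfolding w_def by (simp add: divide_simps) (auto simp: algebra_simps power2_eq_square)
    qed auto
    also have "\<dots> = (\<Sum>j\<in>I-{i}. w i j) - N * l i" using cardN[OF i] by (simp add: sum_subtractf)
    finally show ?thesis unfolding drift_def by (simp only: right_diff_distrib mult.assoc)
  qed
  have w_anti: "w j i = - w i j" for i j
    unfolding w_def by (metis minus_diff_eq minus_divide_right mult.commute)
  have Q_sym: "Q j i = Q i j" for i j unfolding Q_def by (auto simp: algebra_simps)
  have pair': "(p 1 (Y i) - p 1 (Y j)) * w i j \<le> (Q i j (Y i) - Q i j (Y j)) / (x i - x j)"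
    if ij: "i \<in> I" "j \<in> I" "i \<noteq> j" "Y j \<le> Y i" for i j
    using pair_drift_le[of "l i" "l j" "x i" "x j" m] l[OF ij(1)] l[OF ij(2)] xb[OF ij(1)] xb[OF ij(2)]
      ord[OF ij(1-3)] ij(4)
    unfolding p_def Q_def w_def Y_def by simp
  have pair: "(p 1 (Y i) - p 1 (Y j)) * w i j \<le> (Q i j (Y i) - Q i j (Y j)) / (x i - x j)"
    if ij: "i \<in> I" "j \<in> I" "i \<noteq> j" for i j
  proof (cases "Y j \<le> Y i")
    case False
    have "(p 1 (Y j) - p 1 (Y i)) * w j i \<le> (Q j i (Y j) - Q j i (Y i)) / (x j - x i)"
      using pair'[of j i] ij False by auto
    moreover have "(Q i j (Y j) - Q i j (Y i)) / (x j - x i) = (Q i j (Y i) - Q i j (Y j)) / (x i - x j)"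
      by (metis minus_diff_eq minus_divide_divide)
    ultimately show ?thesis unfolding w_anti[of j i] Q_sym[of j i] by (simp add: algebra_simps)
  qed (use pair' ij in auto)
  have anti: "(\<Sum>i\<in>I. \<Sum>j\<in>I-{i}. f i j) = (\<Sum>i\<in>I. \<Sum>j\<in>I-{i}. f j i)" for f :: "'a \<Rightarrow> 'a \<Rightarrow> real"
  proof -
    have "(\<Sum>i\<in>I. \<Sum>j\<in>I-{i}. f i j) = (\<Sum>i\<in>I. \<Sum>j\<in>{j. j \<in> I \<and> i \<noteq> j}. f i j)"
      by (intro sum.cong) auto
    also have "\<dots> = (\<Sum>j\<in>I. \<Sum>i\<in>{i. i \<in> I \<and> i \<noteq> j}. f i j)"
      by (rule sum.swap_restrict[OF I I])
    also have "\<dots> = (\<Sum>i\<in>I. \<Sum>j\<in>I-{i}. f j i)"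
      by (intro sum.cong) auto
    finally show ?thesis .
  qed
  have "2 * (\<Sum>i\<in>I. p 1 (Y i) * (\<Sum>j\<in>I-{i}. w i j)) = 
      (\<Sum>i\<in>I. \<Sum>j\<in>I-{i}. p 1 (Y i) * w i j) + (\<Sum>i\<in>I. \<Sum>j\<in>I-{i}. p 1 (Y j) * w j i)"
    using anti[of "\<lambda>i j. p 1 (Y i) * w i j"] by (simp add: sum_distrib_left)
  also have "\<dots> = (\<Sum>i\<in>I. \<Sum>j\<in>I-{i}. (p 1 (Y i) - p 1 (Y j)) * w i j)"
  proof -
    have "p 1 (Y i) * w i j + p 1 (Y j) * w j i = (p 1 (Y i) - p 1 (Y j)) * w i j" for i j
      unfolding w_anti[of j i] by (simp add: algebra_simps)
    thus ?thesis by (simp only: sum.distrib[symmetric])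
  qed
  also have "\<dots> \<le> (\<Sum>i\<in>I. \<Sum>j\<in>I-{i}. (Q i j (Y i) - Q i j (Y j)) / (x i - x j))"
    by (intro sum_mono pair) auto
  also have "\<dots> = (\<Sum>i\<in>I. \<Sum>j\<in>I-{i}. Q i j (Y i) / (x i - x j)) + (\<Sum>i\<in>I. \<Sum>j\<in>I-{i}. Q j i (Y j) / (x j - x i))"
  proof -
    have "Q i j (Y i) / (x i - x j) + Q j i (Y j) / (x j - x i) = (Q i j (Y i) - Q i j (Y j)) / (x i - x j)" for i j
      unfolding Q_sym[of j i] by (metis diff_divide_distrib minus_diff_eq minus_divide_right diff_conv_add_uminus)
    thus ?thesis by (simp only: sum.distrib[symmetric])
  qed
  also have "\<dots> = 2 * (\<Sum>i\<in>I. \<Sum>j\<in>I-{i}. Q i j (Y i) / (x i - x j))"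
    using anti[of "\<lambda>i j. Q i j (Y i) / (x i - x j)"] by simp
  finally have main: "(\<Sum>i\<in>I. p 1 (Y i) * (\<Sum>j\<in>I-{i}. w i j)) \<le> (\<Sum>i\<in>I. \<Sum>j\<in>I-{i}. Q i j (Y i) / (x i - x j))"
    by simp
  have "(\<Sum>i\<in>I. Y i ^ (m+1) / real (m+1) * drift I \<beta> A B l i) = 
      \<beta> * (\<Sum>i\<in>I. p 1 (Y i) * (\<Sum>j\<in>I-{i}. w i j)) + 
        (\<Sum>i\<in>I. p 1 (Y i) * (- \<beta> * N * l i - A * (2 + l i) + B * (2 - l i)))"
  proof -
    have "(\<Sum>i\<in>I. Y i ^ (m+1) / real (m+1) * drift I \<beta> A B l i) = 
      (\<Sum>i\<in>I. \<beta> * (p 1 (Y i) * (\<Sum>j\<in>I-{i}. w i j)) +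
        p 1 (Y i) * (- \<beta> * N * l i - A * (2 + l i) + B * (2 - l i)))"
    proof (rule sum.cong)
      fix i assume "i \<in> I"
      moreover have "Y i ^ (m+1) / real (m+1) = p 1 (Y i)" unfolding p_def ..
      ultimately show "Y i ^ (m+1) / real (m+1) * drift I \<beta> A B l i = 
        \<beta> * (p 1 (Y i) * (\<Sum>j\<in>I-{i}. w i j)) + p 1 (Y i) * (- \<beta> * N * l i - A * (2 + l i) + B * (2 - l i))"
        by (simp only: drift) (simp add: algebra_simps)
    qed auto
    thus ?thesis by (simp only: sum.distrib sum_distrib_left)
  qed
  also have "\<dots> \<le> \<beta> * (\<Sum>i\<in>I. \<Sum>j\<in>I-{i}. Q i j (Y i) / (x i - x j)) + 
        (\<Sum>i\<in>I. p 1 (Y i) * (- \<beta> * N * l i - A * (2 + l i) + B * (2 - l i)))"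
    using \<beta> by (intro add_right_mono mult_left_mono main) auto
  also have "\<dots> = (\<Sum>i\<in>I. \<beta> * (\<Sum>j\<in>I-{i}. Q i j (Y i) / (x i - x j)) + 
        p 1 (Y i) * (- \<beta> * N * l i - A * (2 + l i) + B * (2 - l i)))"
    by (simp add: sum_distrib_left sum.distrib)
  also have "\<dots> \<le> (\<Sum>i\<in>I. - ((A + B) * (4 - (l i)\<^sup>2) * Y i ^ (m+2) / (16 * real (m+3)) 
          + (A + B) * Y i ^ (m+2) / (real (m+1) * real (m+2))))"
  proof (rule sum_mono)
    fix i assume i: "i \<in> I"
    let ?R = "(A + B) * (4 - (l i)\<^sup>2) * Y i ^ (m+2) / (16 * real (m+3)) 
          + (A + B) * Y i ^ (m+2) / (real (m+1) * real (m+2))"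
    show "\<beta> * (\<Sum>j\<in>I-{i}. Q i j (Y i) / (x i - x j)) + 
        p 1 (Y i) * (- \<beta> * N * l i - A * (2 + l i) + B * (2 - l i)) \<le> - ?R"
    proof (cases "Y i = 0")
      case True
      thus ?thesis by (simp add: p_def Q_def zero_power)
    next
      case False
      define y where "y = Y i"
      have y: "y > 0" "l i = x i + y" using False Y0[of i] unfolding y_def Y_def by auto
      define S where "S = A / (2 - x i) - B / (2 + x i)"
      define c0 where "c0 = (4 - (x i)\<^sup>2) * p 1 y - 2 * x i * p 2 y - p 3 y"
      have N0: "N \<ge> 0" using cardN[OF i] by linarith
      \<comment> \<open>\<open>4 - (x i + r) * (x j + r)\<close> exceeds
        \<open>4 - (x i + r)\<^sup>2\<close> by \<open>(x i + r) * (x i - x j)\<close>. After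
        division only \<open>1 / (x i - x j)\<close> depends on \<open>j\<close>, with coefficient
        \<open>c0\<close>, the diagonal value of \<open>Q\<close>, and the equilibrium equation
        applies.\<close>
      have "(\<Sum>j\<in>I-{i}. Q i j y / (x i - x j)) = (\<Sum>j\<in>I-{i}. c0 * (1 / (x i - x j)) + (x i * p 1 y + p 2 y))"
      proof (rule sum.cong)
        fix j assume "j \<in> I - {i}"
        hence "x i \<noteq> x j" using ord[of i j] i by auto
        thus "Q i j y / (x i - x j) = c0 * (1 / (x i - x j)) + (x i * p 1 y + p 2 y)"
          unfolding Q_def c0_def by (simp add: divide_simps) (simp add: algebra_simps power2_eq_square)
      qed auto
      also have "\<dots> = c0 * (\<Sum>j\<in>I-{i}. 1 / (x i - x j)) + N * (x i * p 1 y + p 2 y)"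
        by (simp only: sum.distrib sum_constant sum_distrib_left[symmetric] cardN[OF i] distrib_left)
      also have "\<beta> * \<dots> = c0 * (\<beta> * (\<Sum>j\<in>I-{i}. 1 / (x i - x j))) + \<beta> * N * (x i * p 1 y + p 2 y)"
        by (simp only: distrib_left mult.assoc mult.left_commute)
      also have "\<beta> * (\<Sum>j\<in>I-{i}. 1 / (x i - x j)) = S" using xe[OF i] unfolding S_def .
      finally have e1: "\<beta> * (\<Sum>j\<in>I-{i}. Q i j y / (x i - x j)) = c0 * S + \<beta> * N * (x i * p 1 y + p 2 y)" .
      have nz: "2 - x i > 0" "2 + x i > 0" using xb[OF i] by auto
      have S1: "S * (4 - (x i)\<^sup>2) = A * (2 + x i) - B * (2 - x i)"
        using nz unfolding S_def by (simp add: divide_simps) (auto simp: algebra_simps power2_eq_square)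
      have S2: "2 * x i * S + (A + B) = A / (2 - x i) * (2 + x i) + B / (2 + x i) * (2 - x i)"
        using nz unfolding S_def by (simp add: divide_simps) (auto simp: algebra_simps power2_eq_square)
      define z where "z = y ^ (m+2)"
      have z0: "z \<ge> 0" using y unfolding z_def by simp
      \<comment> \<open>The gap \<open>1 / (m+1) - 1 / (m+2)\<close> is the source of the damping
        term without the factor \<open>4 - (l i)\<^sup>2\<close>.\<close>
      have p1y: "p 1 y * y = p 2 y + z / (real (m+1) * real (m+2))"
        unfolding p_def z_def by (simp add: divide_simps) (simp add: algebra_simps)
      have p3: "p 3 y = z * y / real (m+3)" "p 2 y = z / real (m+2)"
        unfolding p_def z_def by (auto simp: power_add algebra_simps eval_nat_numeral)
      have "c0 * S + \<beta> * N * (x i * p 1 y + p 2 y) + p 1 y * (- \<beta> * N * l i - A * (2 + l i) + B * (2 - l i))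
         = (S * (4 - (x i)\<^sup>2)) * p 1 y - p 2 y * (2 * x i * S) - p 3 y * S + \<beta> * N * p 2 y
           - (\<beta> * N + A + B) * (p 1 y * y) + p 1 y * (- A * (2 + x i) + B * (2 - x i))"
        unfolding c0_def y by (simp add: algebra_simps)
      also have "\<dots> = - p 2 y * (2 * x i * S + (A + B)) - p 3 y * S - (\<beta> * N + (A + B)) * (z / (real (m+1) * real (m+2)))"
        unfolding S1 p1y by (simp add: algebra_simps)
      also have "\<dots> = - (A / (2 - x i)) * (p 2 y * (2 + x i) + p 3 y) - (B / (2 + x i)) * (p 2 y * (2 - x i) - p 3 y)
           - (\<beta> * N + (A + B)) * (z / (real (m+1) * real (m+2)))"
      proof -
        have "- P * (\<alpha> * h + \<eta> * k) - R * (\<alpha> - \<eta>) - c = - \<alpha> * (P * h + R) - \<eta> * (P * k - R) - c"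
          for \<alpha> \<eta> h k P R c :: real by (simp add: algebra_simps)
        thus ?thesis unfolding S2 by (simp only: S_def)
      qed
      \<comment> \<open>Lowering \<open>p 2 y\<close> to \<open>z / (m+3)\<close> gives it the
        denominator of \<open>p 3 y\<close>, so that \<open>x i + y\<close> recombines to
        \<open>l i\<close>. The quarters come from \<open>2 - x i \<le> 4\<close> and
        \<open>2 + x i \<le> 4\<close>; a second quarter, from
        \<open>4 - (l i)\<^sup>2 \<le> 4 * (2 + l i)\<close> and its mirror image, then yields the
        16.\<close>
      also have "\<dots> \<le> - (A / 4) * (z * (2 + l i) / real (m+3)) - (B / 4) * (z * (2 - l i) / real (m+3))
           - (A + B) * (z / (real (m+1) * real (m+2)))"
      proof -
        have li: "2 + l i > 0" "2 - l i > 0" using l[OF i] by auto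
        have pz: "z / real (m+3) \<le> p 2 y" unfolding p3 using z0 by (intro divide_left_mono) auto
        have a: "z * (2 + l i) / real (m+3) \<le> p 2 y * (2 + x i) + p 3 y"
        proof -
          have "z / real (m+3) * (2 + x i) \<le> p 2 y * (2 + x i)" using pz nz by (intro mult_right_mono) auto
          thus ?thesis unfolding p3(1) y by (simp add: algebra_simps add_divide_distrib)
        qed
        have b: "z * (2 - l i) / real (m+3) \<le> p 2 y * (2 - x i) - p 3 y"
        proof -
          have "z / real (m+3) * (2 - x i) \<le> p 2 y * (2 - x i)" using pz nz by (intro mult_right_mono) auto
          thus ?thesis unfolding p3(1) y by (simp add: algebra_simps add_divide_distrib diff_divide_distrib)
        qed
        have "(A / 4) * (z * (2 + l i) / real (m+3)) \<le> (A / (2 - x i)) * (p 2 y * (2 + x i) + p 3 y)"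
          using A nz xb[OF i] a z0 li by (intro mult_mono divide_left_mono) auto
        moreover have "(B / 4) * (z * (2 - l i) / real (m+3)) \<le> (B / (2 + x i)) * (p 2 y * (2 - x i) - p 3 y)"
          using B nz xb[OF i] b z0 li by (intro mult_mono divide_left_mono) auto
        moreover have "0 \<le> \<beta> * N * (z / (real (m+1) * real (m+2)))"
          using \<beta> N0 z0 by auto
        ultimately show ?thesis by (simp only: ring_distribs)
      qed
      also have "\<dots> \<le> - ((A + B) * (4 - (l i)\<^sup>2) * z / (16 * real (m+3)) 
          + (A + B) * z / (real (m+1) * real (m+2)))"
      proof -
        have li: "2 + l i > 0" "2 - l i > 0" "2 + l i \<le> 4" "2 - l i \<le> 4" using l[OF i] by auto
        have f: "4 - (l i)\<^sup>2 = (2 + l i) * (2 - l i)" by (simp add: algebra_simps power2_eq_square)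
        have "4 - (l i)\<^sup>2 \<le> 4 * (2 + l i)" "4 - (l i)\<^sup>2 \<le> 4 * (2 - l i)"
          unfolding f using li mult_right_mono[of "2 - l i" 4 "2 + l i"] mult_right_mono[of "2 + l i" 4 "2 - l i"]
          by (auto simp: mult.commute)
        hence "A * (4 - (l i)\<^sup>2) \<le> A * (4 * (2 + l i))" "B * (4 - (l i)\<^sup>2) \<le> B * (4 * (2 - l i))"
          using A B by (auto intro!: mult_left_mono)
        hence "(A + B) * (4 - (l i)\<^sup>2) \<le> 4 * (A * (2 + l i) + B * (2 - l i))"
          by (simp add: algebra_simps)
        hence "(A + B) * (4 - (l i)\<^sup>2) * (z / (16 * real (m+3))) \<le> 4 * (A * (2 + l i) + B * (2 - l i)) * (z / (16 * real (m+3)))"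
          using z0 by (intro mult_right_mono) auto
        also have "\<dots> = (A / 4) * (z * (2 + l i) / real (m+3)) + (B / 4) * (z * (2 - l i) / real (m+3))"
          by (simp add: divide_simps) (simp add: algebra_simps)
        finally show ?thesis by simp
      qed
      finally show ?thesis using e1 unfolding y_def[symmetric] z_def[symmetric] by simp
    qed
  qed
  also have "\<dots> = - (\<Sum>i\<in>I. (A + B) * (4 - (l i)\<^sup>2) * Y i ^ (m+2) / (16 * real (m+3)) 
          + (A + B) * Y i ^ (m+2) / (real (m+1) * real (m+2)))"
    by (rule sum_negf)
  finally show ?thesis .
qed

subsection \<open>Jacobi polynomials and the equilibrium of their zeros\<close>

lemma jacobi_weight_absolutely_integrable:
  fixes a b c :: real
  assumes "a > -1" "b > -1" "c > 0"
  shows "(\<lambda>u. (c - u) powr a * (c + u) powr b) absolutely_integrable_on {-c..c}"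
proof -
  have "((\<lambda>t. t powr (b + 1 - 1) * (1 - t) powr (a + 1 - 1)) has_integral Beta (b+1) (a+1)) (cbox 0 1)"
    using has_integral_Beta_real[of "b+1" "a+1"] assms by simp
  from has_integral_affinity[OF this, of "1/(2*c)" "1/2"]
  have "(\<lambda>u. (u / (2*c) + 1/2) powr b * (1 - (u / (2*c) + 1/2)) powr a) integrable_on
      ((\<lambda>x. 2 * c * x - c) ` {0..1})"
    using assms by (auto simp: integrable_on_def field_simps)
  also have "(\<lambda>x. 2 * c * x - c) ` {0..1} = {-c..c}"
    using assms by (simp add: image_affinity_atLeastAtMost_diff)
  finally have i: "(\<lambda>u. (u / (2*c) + 1/2) powr b * (1 - (u / (2*c) + 1/2)) powr a) integrable_on {-c..c}" .
  have "(\<lambda>u. (2*c) powr (a + b) * ((u / (2*c) + 1/2) powr b * (1 - (u / (2*c) + 1/2)) powr a)) integrable_on {-c..c}"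
    using integrable_on_cmult_left[OF i, of "(2*c) powr (a + b)"] by simp
  moreover have "(2*c) powr (a + b) * ((u / (2*c) + 1/2) powr b * (1 - (u / (2*c) + 1/2)) powr a)
     = (c - u) powr a * (c + u) powr b" if "u \<in> {-c..c}" for u
  proof -
    have e: "2 * c * (u / (2*c) + 1/2) = c + u" "2 * c * (1 - (u / (2*c) + 1/2)) = c - u"
      using assms by (simp_all add: distrib_left right_diff_distrib)
    have "(c + u) powr b = (2*c) powr b * (u / (2*c) + 1/2) powr b"
      "(c - u) powr a = (2*c) powr a * (1 - (u / (2*c) + 1/2)) powr a"
      unfolding powr_mult[symmetric] e by simp_all
    thus ?thesis using assms by (simp add: powr_add)
  qed
  ultimately have "(\<lambda>u. (c - u) powr a * (c + u) powr b) integrable_on {-c..c}"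
    by (metis (no_types, lifting) integrable_cong)
  thus ?thesis by (intro nonnegative_absolutely_integrable_1) auto
qed

lemma poly_weight_integrable:
  assumes "g > -1" "d > -1"
  shows "(\<lambda>x. poly q x * jacobi_weight g d x) integrable_on {-1..1}"
proof -
  have "(\<lambda>x. poly q x * jacobi_weight g d x) absolutely_integrable_on {-1..1}"
  proof (rule absolutely_integrable_bounded_measurable_product_real)
    show "jacobi_weight g d absolutely_integrable_on {-1..1}"
      using jacobi_weight_absolutely_integrable[of g d 1] assms unfolding jacobi_weight_def[abs_def] by simp
    have c: "continuous_on {-1..1} (poly q)" by (intro continuous_intros)
    thus "poly q \<in> borel_measurable (lebesgue_on {-1..1})"
      by (intro continuous_imp_measurable_on_sets_lebesgue) auto
    show "bounded (poly q ` {-1..1})"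
      using c compact_continuous_image compact_imp_bounded by blast
  qed auto
  thus ?thesis by (rule set_lebesgue_integral_eq_integral)
qed

lemma poly_weight_integral_0_imp_0:
  assumes "g > -1" "d > -1" and nonneg: "\<And>x. -1 < x \<Longrightarrow> x < 1 \<Longrightarrow> 0 \<le> poly q x"
    and "integral {-1..1} (\<lambda>x. poly q x * jacobi_weight g d x) = 0"
  shows "q = 0"
proof -
  \<comment> \<open>The weight may be singular at \<open>-1\<close> and \<open>1\<close>, so the argument is localised to \<open>[-1/2, 1/2]\<close>.\<close>
  let ?f = "\<lambda>x. poly q x * jacobi_weight g d x"
  have cont: "continuous_on {-1/2..1/2} ?f"
    unfolding jacobi_weight_def by (intro continuous_intros) auto
  have nn: "0 \<le> ?f x" if "x \<in> {-1..1}" for x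
  proof (cases "x = -1 \<or> x = 1")
    case True
    thus ?thesis by (auto simp: jacobi_weight_def)
  next
    case False
    thus ?thesis using that nonneg[of x] by (auto simp: jacobi_weight_def)
  qed
  have "integral {-1/2..1/2} ?f \<le> integral {-1..1} ?f"
    using nn by (intro integral_subset_le integrable_continuous_interval[OF cont]
        poly_weight_integrable assms) auto
  moreover have "0 \<le> integral {-1/2..1/2} ?f"
    using nn by (intro integral_nonneg integrable_continuous_interval cont) auto
  ultimately have "integral {-1/2..1/2} ?f = 0" using assms by auto
  hence z: "\<And>x. x \<in> {-1/2..1/2} \<Longrightarrow> ?f x = 0"
    using integral_eq_0_iff[OF cont] nn by auto
  have "{-1/2..1/2} \<subseteq> {x. poly q x = 0}"
    using z by (auto simp: jacobi_weight_def)
  moreover have "infinite {-1/2..1/2::real}" by simp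
  ultimately show ?thesis using poly_roots_finite finite_subset by blast
qed

section \<open>The Jacobi differential operator and its polynomial eigenvectors\<close>

definition jacobi_op :: "real \<Rightarrow> real \<Rightarrow> real poly \<Rightarrow> real poly" where
  "jacobi_op g d p = [:1, 0, -1:] * pderiv (pderiv p) + [:d - g, -(g + d + 2):] * pderiv p"

lemma jacobi_op_smult: "jacobi_op g d (smult c p) = smult c (jacobi_op g d p)"
  unfolding jacobi_op_def by (simp add: pderiv_smult smult_add_right)

text \<open>Lagrange's identity: \<open>h\<close> is \<open>1 - x\<^sup>2\<close> times the weight
  times the Wronskian \<open>W\<close>, and its derivative is \<open>\<mu> - \<nu>\<close> times the
  integrand. It vanishes at both endpoints because \<open>g + 1\<close> and \<open>d + 1\<close> are
  positive.\<close>

lemma jacobi_op_eigen_orthogonal: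
  assumes "g > -1" "d > -1" "jacobi_op g d p = smult \<mu> p" "jacobi_op g d q = smult \<nu> q" "\<mu> \<noteq> \<nu>"
  shows "integral {-1..1} (\<lambda>x. poly p x * poly q x * jacobi_weight g d x) = 0"
proof -
  define W where "W = pderiv p * q - p * pderiv q"
  define h where "h = (\<lambda>x. (1 - x) powr (g+1) * (1 + x) powr (d+1) * poly W x)"
  have "((\<lambda>x. (\<mu> - \<nu>) * (poly p x * poly q x * jacobi_weight g d x)) has_integral (h 1 - h (-1))) {-1..1}"
  proof (rule fundamental_theorem_of_calculus_interior)
    show "continuous_on {-1..1} h"
      unfolding h_def using assms by (intro continuous_intros continuous_on_powr') auto
    fix x :: real assume x: "x \<in> {-1<..<1}"
    have p1: "(1 - x) powr (g+1) = (1 - x) * (1 - x) powr g" "(1 + x) powr (d+1) = (1 + x) * (1 + x) powr d"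
      using x by (auto simp: powr_add)
    have e: "poly (pderiv (pderiv p)) x * (1 - x\<^sup>2) + (d - g - (g + d + 2) * x) * poly (pderiv p) x = \<mu> * poly p x"
      "poly (pderiv (pderiv q)) x * (1 - x\<^sup>2) + (d - g - (g + d + 2) * x) * poly (pderiv q) x = \<nu> * poly q x"
      using arg_cong[OF assms(3), of "\<lambda>p. poly p x"] arg_cong[OF assms(4), of "\<lambda>p. poly p x"]
      unfolding jacobi_op_def by (simp_all add: algebra_simps power2_eq_square)
    have "(h has_real_derivative
       (- (g+1) * (1 - x) powr g * (1 + x) powr (d+1) + (d+1) * (1 + x) powr d * (1 - x) powr (g+1)) * poly W x
       + (1 - x) powr (g+1) * (1 + x) powr (d+1) * poly (pderiv W) x) (at x)"
      unfolding h_def using x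
      by (auto intro!: derivative_eq_intros poly_DERIV simp: algebra_simps)
    also have "pderiv W = pderiv (pderiv p) * q - p * pderiv (pderiv q)"
      unfolding W_def by (simp add: pderiv_diff pderiv_mult)
    also have "(- (g+1) * (1 - x) powr g * (1 + x) powr (d+1) + (d+1) * (1 + x) powr d * (1 - x) powr (g+1)) * poly W x
       + (1 - x) powr (g+1) * (1 + x) powr (d+1) * poly (pderiv (pderiv p) * q - p * pderiv (pderiv q)) x
       = jacobi_weight g d x * 
         ((poly (pderiv (pderiv p)) x * (1 - x\<^sup>2) + (d - g - (g + d + 2) * x) * poly (pderiv p) x) * poly q x
         - (poly (pderiv (pderiv q)) x * (1 - x\<^sup>2) + (d - g - (g + d + 2) * x) * poly (pderiv q) x) * poly p x)"
      unfolding p1 jacobi_weight_def W_def by (simp add: algebra_simps power2_eq_square)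
    also have "\<dots> = (\<mu> - \<nu>) * (poly p x * poly q x * jacobi_weight g d x)"
      unfolding e by (simp add: algebra_simps)
    finally show "(h has_vector_derivative (\<mu> - \<nu>) * (poly p x * poly q x * jacobi_weight g d x)) (at x)"
      by (simp add: has_real_derivative_iff_has_vector_derivative)
  qed auto
  moreover have "h 1 - h (-1) = 0" unfolding h_def using assms by simp
  ultimately have "((\<lambda>x. (\<mu> - \<nu>) * (poly p x * poly q x * jacobi_weight g d x)) has_integral 0) {-1..1}" by simp
  from has_integral_mult_right[OF this, of "1 / (\<mu> - \<nu>)"] assms(5)
  have "((\<lambda>x. poly p x * poly q x * jacobi_weight g d x) has_integral 0) {-1..1}" by simp
  thus ?thesis by (rule integral_unique)
qed

text \<open>In powers of \<open>x - 1\<close> the eigenvalue equation becomes a two-term recursion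
  for the coefficients, that of a hypergeometric series; the factor \<open>n - k\<close> in it stops
  the series at degree \<open>n\<close>.\<close>

lemma jacobi_op_eigen_exists:
  fixes g d :: real
  assumes "g > -1" "d > -1"
  obtains p where "degree p = n" "lead_coeff p = 1"
    "jacobi_op g d p = smult (- (real n * (real n + g + d + 1))) p"
proof -
  define s where "s = g + d + 1"
  define c where "c = rec_nat 1 (\<lambda>k x. x * ((real n - real k) * (real n + real k + s) / (2 * (real k + 1) * (real k + 1 + g))))"
  have c0: "c 0 = 1" and cS: "c (Suc k) = c k * ((real n - real k) * (real n + real k + s) / (2 * (real k + 1) * (real k + 1 + g)))" for k
    unfolding c_def by auto
  have c_nz: "k \<le> n \<Longrightarrow> c k \<noteq> 0" for k
  proof (induction k)
    case (Suc k)
    have "real n + real k + s \<noteq> 0" "real k + 1 + g \<noteq> 0" using Suc assms unfolding s_def by auto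
    thus ?case using Suc by (auto simp: cS)
  qed (simp add: c0)
  have c_z: "k > n \<Longrightarrow> c k = 0" for k
  proof (induction k)
    case (Suc k)
    thus ?case by (cases "k = n") (auto simp: cS)
  qed simp
  have rec: "2 * (real k + 1) * (real k + 1 + g) * c (Suc k) = (real n * (real n + s) - real k * (real k + s)) * c k" for k
  proof -
    have "2 * (real k + 1) * (real k + 1 + g) \<noteq> 0" using assms by auto
    moreover have "D * (x * (E / D)) = x * E" if "D \<noteq> 0" for D x E :: real using that by simp
    ultimately have "2 * (real k + 1) * (real k + 1 + g) * c (Suc k) = c k * ((real n - real k) * (real n + real k + s))"
      unfolding cS by blast
    thus ?thesis by (simp add: algebra_simps)
  qed
  define Q where "Q = Abs_poly c"
  have coeffQ: "coeff Q k = c k" for k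
    unfolding Q_def using c_z by (subst coeff_Abs_poly[of n]) auto
  have ode: "[:0, 2, 1:] * pderiv (pderiv Q) + [:2 * (g + 1), s + 1:] * pderiv Q = smult (real n * (real n + s)) Q"
  proof (rule poly_eqI)
    fix k
    show "coeff ([:0, 2, 1:] * pderiv (pderiv Q) + [:2 * (g + 1), s + 1:] * pderiv Q) k = 
       coeff (smult (real n * (real n + s)) Q) k"
      using rec[of k]
      by (cases k; cases "k - 1") (auto simp: coeff_pderiv coeffQ coeff_pCons algebra_simps split: nat.splits)
  qed
  have dQ: "degree Q = n"
    using c_nz c_z by (intro antisym degree_le le_degree) (auto simp: coeffQ)
  define P where "P = pcompose Q [:-1, 1:]"
  have dP: "degree P = n" unfolding P_def using dQ by (simp add: degree_pcompose)
  have lP: "lead_coeff P = c n" unfolding P_def using dQ by (subst lead_coeff_comp) (auto simp: coeffQ)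
  have "jacobi_op g d P = smult (- (real n * (real n + s))) P"
  proof -
    have d1: "pderiv P = pcompose (pderiv Q) [:-1, 1:]" "pderiv (pderiv P) = pcompose (pderiv (pderiv Q)) [:-1, 1:]"
      unfolding P_def by (simp_all add: pderiv_pcompose pderiv_pCons)
    have "smult (real n * (real n + s)) P = pcompose (smult (real n * (real n + s)) Q) [:-1,1:]"
      unfolding P_def by (simp add: pcompose_smult)
    also have "\<dots> = pcompose [:0,2,1:] [:-1,1:] * pderiv (pderiv P) + pcompose [:2 * (g + 1), s + 1:] [:-1,1:] * pderiv P"
      unfolding ode[symmetric] d1(2) unfolding d1(1) by (simp only: pcompose_add pcompose_mult)
    also have "pcompose [:0,2,1:] [:-1,1:] = - [:1,0,-1::real:]" by (simp add: pcompose_pCons)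
    also have "pcompose [:2 * (g + 1), s + 1:] [:-1,1:] = - [:d - g, -(g + d + 2):]"
      by (simp add: pcompose_pCons s_def)
    finally have "smult (real n * (real n + s)) P = - jacobi_op g d P"
      unfolding jacobi_op_def by (simp only: mult_minus_left minus_add_distrib)
    thus ?thesis by (metis minus_minus smult_minus_left)
  qed
  hence "jacobi_op g d (smult (1 / c n) P) = smult (- (real n * (real n + g + d + 1))) (smult (1 / c n) P)"
    unfolding jacobi_op_smult s_def by (simp add: algebra_simps)
  moreover have "degree (smult (1 / c n) P) = n" "lead_coeff (smult (1 / c n) P) = 1"
    using c_nz[of n] dP lP by auto
  ultimately show ?thesis using that by blast
qed


section \<open>Existence and uniqueness of the orthogonal family\<close>

definition jacobi_family :: "real \<Rightarrow> real \<Rightarrow> (nat \<Rightarrow> real poly) \<Rightarrow> bool" where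
  "jacobi_family g d P \<longleftrightarrow> (\<forall>k. degree (P k) = k \<and>
        lead_coeff (P k) = pochhammer (real k + g + d + 1) k / (2 ^ k * fact k)) \<and>
      (\<forall>k m. k \<noteq> m \<longrightarrow>
        integral {-1..1} (\<lambda>x. poly (P k) x * poly (P m) x * jacobi_weight g d x) = 0)"

lemma jacobi_lead_coeff_nonzero:
  assumes "g > -1" "d > -1"
  shows "pochhammer (real k + g + d + 1) k / (2 ^ k * fact k) \<noteq> 0"
\<comment> \<open>For \<open>k = 0\<close> the base \<open>g + d + 1\<close> may be zero or
  negative, but the product is empty. For \<open>k > 0\<close> the base exceeds \<open>k - 1\<close>
  and all factors are positive.\<close>
proof (cases k)
  case (Suc j)
  hence "pochhammer (real k + g + d + 1) k > 0" using assms by (intro pochhammer_pos) auto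
  thus ?thesis by auto
qed auto

lemma jacobi_familyD:
  assumes "jacobi_family g d P"
  shows "degree (P k) = k" "coeff (P k) k = pochhammer (real k + g + d + 1) k / (2 ^ k * fact k)"
  using assms unfolding jacobi_family_def by metis+

lemma jacobi_family_exists:
  assumes "g > -1" "d > -1"
  obtains P where "jacobi_family g d P"
    "\<And>k. jacobi_op g d (P k) = smult (- (real k * (real k + g + d + 1))) (P k)"
proof -
  have "\<exists>p. degree p = k \<and> lead_coeff p = 1 \<and> jacobi_op g d p = smult (- (real k * (real k + g + d + 1))) p" for k
    using jacobi_op_eigen_exists[OF assms] by metis
  then obtain E where E: "\<And>k. degree (E k) = k" "\<And>k. lead_coeff (E k) = 1"
    "\<And>k. jacobi_op g d (E k) = smult (- (real k * (real k + g + d + 1))) (E k)" by metis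
  define P where "P = (\<lambda>k. smult (pochhammer (real k + g + d + 1) k / (2 ^ k * fact k)) (E k))"
  have op: "jacobi_op g d (P k) = smult (- (real k * (real k + g + d + 1))) (P k)" for k
    unfolding P_def jacobi_op_smult E by (simp add: mult.commute)
  \<comment> \<open>Two eigenvalues differ by \<open>(k - m) * (k + m + g + d + 1)\<close>; distinct
    naturals have \<open>k + m \<ge> 1\<close>, which makes the second factor positive.\<close>
  have "real k * (real k + g + d + 1) \<noteq> real m * (real m + g + d + 1)" if "k \<noteq> m" for k m
  proof
    assume "real k * (real k + g + d + 1) = real m * (real m + g + d + 1)"
    hence "(real k - real m) * (real k + real m + g + d + 1) = 0" by (simp add: algebra_simps)
    moreover have "real k + real m \<ge> 1" using that by linarith
    ultimately show False using that assms by auto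
  qed
  hence "integral {-1..1} (\<lambda>x. poly (P k) x * poly (P m) x * jacobi_weight g d x) = 0" if "k \<noteq> m" for k m
    using that by (intro jacobi_op_eigen_orthogonal[OF assms op op]) auto
  moreover have "degree (P k) = k" "lead_coeff (P k) = pochhammer (real k + g + d + 1) k / (2 ^ k * fact k)" for k
    using E(1)[of k] E(2)[of k] jacobi_lead_coeff_nonzero[OF assms, of k] unfolding P_def by auto
  ultimately show ?thesis using op by (intro that[of P]) (auto simp: jacobi_family_def)
qed

lemma jacobi_family_orthogonal_lower:
  assumes gd: "g > -1" "d > -1" and P: "jacobi_family g d P" and "degree q < n"
  shows "integral {-1..1} (\<lambda>x. poly q x * poly (P n) x * jacobi_weight g d x) = 0"
  using assms(4)
proof (induction "degree q" arbitrary: q rule: less_induct)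
  case less
  define k where "k = degree q"
  have Pk: "degree (P k) = k" "coeff (P k) k \<noteq> 0"
    using jacobi_familyD[OF P, of k] jacobi_lead_coeff_nonzero[OF gd, of k] by simp_all
  define c where "c = lead_coeff q / coeff (P k) k"
  define r where "r = q - smult c (P k)"
  have int: "(\<lambda>x. poly (p1 * p2) x * jacobi_weight g d x) integrable_on {-1..1}" for p1 p2
    by (rule poly_weight_integrable[OF gd])
  have "integral {-1..1} (\<lambda>x. poly r x * poly (P n) x * jacobi_weight g d x) = 0"
  proof (cases "r = 0")
    case False
    have "degree r \<le> k" unfolding r_def k_def[symmetric] using Pk by (intro degree_diff_le) (auto simp: k_def)
    moreover have "coeff r k = 0" unfolding r_def c_def using Pk by (simp add: k_def)
    ultimately have "degree r < k"
      using False by (metis leading_coeff_0_iff le_neq_implies_less)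
    thus ?thesis using less.hyps[of r] less.prems unfolding k_def by auto
  qed auto
  moreover have "integral {-1..1} (\<lambda>x. poly (P k) x * poly (P n) x * jacobi_weight g d x) = 0"
    using P less.prems unfolding jacobi_family_def k_def by auto
  moreover have "integral {-1..1} (\<lambda>x. poly q x * poly (P n) x * jacobi_weight g d x) =
     integral {-1..1} (\<lambda>x. poly (r * P n) x * jacobi_weight g d x + c * (poly (P k * P n) x * jacobi_weight g d x))"
    unfolding r_def by (intro arg_cong2[of _ _ _ _ integral] refl ext) (simp add: algebra_simps)
  moreover have "\<dots> = integral {-1..1} (\<lambda>x. poly (r * P n) x * jacobi_weight g d x)
     + integral {-1..1} (\<lambda>x. c * (poly (P k * P n) x * jacobi_weight g d x))"
    using integrable_on_cmult_left[OF int, of c] by (intro Henstock_Kurzweil_Integration.integral_add int) auto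
  moreover have "integral {-1..1} (\<lambda>x. c * (poly (P k * P n) x * jacobi_weight g d x))
     = c * integral {-1..1} (\<lambda>x. poly (P k * P n) x * jacobi_weight g d x)"
    by (rule integral_mult_right)
  ultimately show ?case by simp
qed

text \<open>Members of degree \<open>k\<close> of two such families share their leading coefficient.
  Their difference therefore has lower degree and is orthogonal to both, hence to itself.\<close>

lemma jacobi_poly_eqI:
  assumes gd: "g > -1" "d > -1" and P: "jacobi_family g d P"
  shows "jacobi_poly g d = P"
  unfolding jacobi_poly_def jacobi_family_def[symmetric]
proof (rule the_equality)
  fix R assume R: "jacobi_family g d R"
  show "R = P"
  proof
    fix k
    define D where "D = R k - P k"
    have eq: "degree (R k) = k" "degree (P k) = k" "coeff (R k) k = coeff (P k) k"
      using jacobi_familyD[OF R, of k] jacobi_familyD[OF P, of k] by simp_all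
    have "D = 0"
    proof (rule ccontr)
      assume nz: "D \<noteq> 0"
      have "degree D \<le> k" unfolding D_def using eq by (intro degree_diff_le) auto
      moreover have "coeff D k = 0" unfolding D_def using eq by simp
      ultimately have deg: "degree D < k" using nz by (metis leading_coeff_0_iff le_neq_implies_less)
      have int: "(\<lambda>x. poly (p1 * p2) x * jacobi_weight g d x) integrable_on {-1..1}" for p1 p2
        by (rule poly_weight_integrable[OF gd])
      have "integral {-1..1} (\<lambda>x. poly (D * D) x * jacobi_weight g d x) =
        integral {-1..1} (\<lambda>x. poly (D * R k) x * jacobi_weight g d x - poly (D * P k) x * jacobi_weight g d x)"
        by (intro arg_cong2[of _ _ _ _ integral] refl ext) (simp add: D_def algebra_simps)
      also have "\<dots> = integral {-1..1} (\<lambda>x. poly (D * R k) x * jacobi_weight g d x) - 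
        integral {-1..1} (\<lambda>x. poly (D * P k) x * jacobi_weight g d x)"
        by (intro Henstock_Kurzweil_Integration.integral_diff int)
      also have "\<dots> = 0"
        using jacobi_family_orthogonal_lower[OF gd R deg] jacobi_family_orthogonal_lower[OF gd P deg] by simp
      finally have "D * D = 0"
        by (intro poly_weight_integral_0_imp_0[OF gd]) auto
      thus False using nz by simp
    qed
    thus "R k = P k" unfolding D_def by simp
  qed
qed (rule P)

section \<open>Zeros of Jacobi polynomials and Stieltjes' equations\<close>

lemma poly_sign_changes:
  fixes p :: "real poly"
  assumes "p \<noteq> 0"
  shows "\<exists>S. finite S \<and> S \<subseteq> {x. -1 < x \<and> x < 1 \<and> poly p x = 0} \<and>
    ((\<forall>x. -1 < x \<and> x < 1 \<longrightarrow> 0 \<le> poly (p * (\<Prod>r\<in>S. [:-r, 1:])) x) \<or>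
     (\<forall>x. -1 < x \<and> x < 1 \<longrightarrow> poly (p * (\<Prod>r\<in>S. [:-r, 1:])) x \<le> 0))"
  using assms
proof (induction "degree p" arbitrary: p rule: less_induct)
  case less
  show ?case
  proof (cases "\<exists>r. -1 < r \<and> r < 1 \<and> poly p r = 0")
    case False
    have "(\<forall>x. -1 < x \<and> x < 1 \<longrightarrow> 0 \<le> poly p x) \<or> (\<forall>x. -1 < x \<and> x < 1 \<longrightarrow> poly p x \<le> 0)"
    proof (rule ccontr)
      assume "\<not> ?thesis"
      then obtain x y where xy: "-1 < x" "x < 1" "poly p x < 0" "-1 < y" "y < 1" "0 < poly p y" by force
      show False
      proof (cases "x < y")
        case True
        from poly_IVT_pos[OF this xy(3,6)] xy False show False by auto
      next
        case c: False
        hence "y < x" using xy by (cases "x = y") auto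
        from poly_IVT_neg[OF this xy(6,3)] xy False show False by auto
      qed
    qed
    thus ?thesis by (intro exI[of _ "{}"]) auto
  next
    case True
    then obtain r where r: "-1 < r" "r < 1" "poly p r = 0" by auto
    then obtain p' where p': "p = [:-r, 1:] * p'" by (auto simp: poly_eq_0_iff_dvd dvd_def)
    have nz: "p' \<noteq> 0" using p' less.prems by auto
    hence "degree p = Suc (degree p')" unfolding p' by (subst degree_mult_eq) auto
    with less.hyps[OF _ nz] obtain S where S: "finite S" "S \<subseteq> {x. -1 < x \<and> x < 1 \<and> poly p' x = 0}"
      "(\<forall>x. -1 < x \<and> x < 1 \<longrightarrow> 0 \<le> poly (p' * (\<Prod>r\<in>S. [:-r, 1:])) x) \<or>
       (\<forall>x. -1 < x \<and> x < 1 \<longrightarrow> poly (p' * (\<Prod>r\<in>S. [:-r, 1:])) x \<le> 0)" by auto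
    show ?thesis
    \<comment> \<open>\<open>S\<close> collects the roots of odd multiplicity. Each linear factor
      split off toggles the membership of its root, so that the product with \<open>p\<close>
      changes only by even powers and keeps its sign.\<close>
    proof (cases "r \<in> S")
      case True
      have "p * (\<Prod>r\<in>S-{r}. [:-r, 1:]) = p' * (\<Prod>r\<in>S. [:-r, 1:])"
        unfolding p' prod.remove[OF S(1) True] by (simp only: ac_simps)
      thus ?thesis using S by (intro exI[of _ "S - {r}"]) (auto simp: p')
    next
      case False
      have "p * (\<Prod>r\<in>insert r S. [:-r, 1:]) = [:-r, 1:]\<^sup>2 * (p' * (\<Prod>r\<in>S. [:-r, 1:]))"
        unfolding p' prod.insert[OF S(1) False] by (simp only: ac_simps power2_eq_square)
      hence e: "poly (p * (\<Prod>r\<in>insert r S. [:-r, 1:])) x = (x - r)\<^sup>2 * poly (p' * (\<Prod>r\<in>S. [:-r, 1:])) x" for x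
        by (simp only: poly_mult poly_power) simp
      show ?thesis
      proof (intro exI[of _ "insert r S"] conjI)
        show "insert r S \<subseteq> {x. - 1 < x \<and> x < 1 \<and> poly p x = 0}" using S r by (auto simp: p')
        show "(\<forall>x. -1 < x \<and> x < 1 \<longrightarrow> 0 \<le> poly (p * (\<Prod>r\<in>insert r S. [:-r, 1:])) x) \<or>
          (\<forall>x. -1 < x \<and> x < 1 \<longrightarrow> poly (p * (\<Prod>r\<in>insert r S. [:-r, 1:])) x \<le> 0)"
          using S(3) unfolding e by (meson mult_nonneg_nonneg mult_nonneg_nonpos zero_le_power2)
      qed (use S in auto)
    qed
  qed
qed

lemma degree_prod_linear: "finite S \<Longrightarrow> degree (\<Prod>r\<in>S. [:-r, 1:]) = card S"
  for S :: "real set"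
  by (subst degree_prod_eq_sum_degree) auto

lemma prod_linear_dvd:
  fixes p :: "real poly"
  assumes "finite S" "\<And>r. r \<in> S \<Longrightarrow> poly p r = 0"
  shows "(\<Prod>r\<in>S. [:-r, 1:]) dvd p"
  using assms
proof (induction rule: finite_induct)
  case (insert r S)
  then obtain t where t: "p = (\<Prod>r\<in>S. [:-r, 1:]) * t" by (auto simp: dvd_def)
  have "poly (\<Prod>r\<in>S. [:-r, 1:]) r \<noteq> 0" using insert by (auto simp: poly_prod)
  moreover have "poly p r = 0" using insert by simp
  ultimately have "poly t r = 0" using t by simp
  then obtain u where "t = [:-r, 1:] * u" by (auto simp: poly_eq_0_iff_dvd dvd_def)
  hence "p = (\<Prod>r\<in>insert r S. [:-r, 1:]) * u"
    unfolding t prod.insert[OF insert(1,2)] by (simp only: ac_simps)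
  thus ?case by (rule dvdI)
qed auto

text \<open>With fewer than \<open>n\<close> sign changes in the interval, \<open>P n\<close> would
  be orthogonal to the product \<open>q\<close> of the corresponding linear factors, while
  \<open>P n * q\<close> has constant sign there and so would be 0. Thus \<open>q\<close> has degree
  at least \<open>n\<close>; as it divides \<open>P n\<close>, it is \<open>P n\<close> up to a
  constant.\<close>

lemma jacobi_poly_factor:
  assumes gd: "g > -1" "d > -1"
  obtains S c where "finite S" "card S = n" "S \<subseteq> {-1<..<1}" "c \<noteq> 0"
    "jacobi_poly g d n = smult c (\<Prod>r\<in>S. [:-r, 1:])"
    "jacobi_op g d (jacobi_poly g d n) = smult (- (real n * (real n + g + d + 1))) (jacobi_poly g d n)"
proof -
  obtain P where P: "jacobi_family g d P"
    and op: "\<And>k. jacobi_op g d (P k) = smult (- (real k * (real k + g + d + 1))) (P k)"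
    using jacobi_family_exists[OF gd] by blast
  have J: "jacobi_poly g d = P" by (rule jacobi_poly_eqI[OF gd P])
  have deg: "degree (P n) = n" and nz: "P n \<noteq> 0"
    using jacobi_familyD[OF P, of n] jacobi_lead_coeff_nonzero[OF gd, of n] by (simp, metis coeff_0)
  obtain S where S: "finite S" "S \<subseteq> {x. -1 < x \<and> x < 1 \<and> poly (P n) x = 0}"
    "(\<forall>x. -1 < x \<and> x < 1 \<longrightarrow> 0 \<le> poly (P n * (\<Prod>r\<in>S. [:-r, 1:])) x) \<or>
     (\<forall>x. -1 < x \<and> x < 1 \<longrightarrow> poly (P n * (\<Prod>r\<in>S. [:-r, 1:])) x \<le> 0)"
    using poly_sign_changes[OF nz] by auto
  define q where "q = (\<Prod>r\<in>S. [:-r, 1:])"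
  have q: "q \<noteq> 0" "degree q = card S" unfolding q_def using S(1) degree_prod_linear by auto
  have "card S \<ge> n"
  proof (rule ccontr)
    assume "\<not> card S \<ge> n"
    hence 0: "integral {-1..1} (\<lambda>x. poly (P n * q) x * jacobi_weight g d x) = 0"
      using jacobi_family_orthogonal_lower[OF gd P, of q n] q by (simp add: mult.commute)
    have "P n * q = 0"
      using S(3)
    proof
      assume "\<forall>x. -1 < x \<and> x < 1 \<longrightarrow> 0 \<le> poly (P n * (\<Prod>r\<in>S. [:-r, 1:])) x"
      thus ?thesis using 0 by (intro poly_weight_integral_0_imp_0[OF gd]) (auto simp: q_def)
    next
      assume "\<forall>x. -1 < x \<and> x < 1 \<longrightarrow> poly (P n * (\<Prod>r\<in>S. [:-r, 1:])) x \<le> 0"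
      hence "- (P n * q) = 0" using 0 by (intro poly_weight_integral_0_imp_0[OF gd]) (auto simp: q_def)
      thus ?thesis by simp
    qed
    thus False using nz q by simp
  qed
  moreover have "q dvd P n"
    unfolding q_def
    using S by (intro prod_linear_dvd) auto
  then obtain t where t: "P n = q * t" by (auto simp: dvd_def)
  moreover from t have "t \<noteq> 0" using nz by auto
  ultimately have "degree t = 0" "card S = n" using deg q by (auto simp: degree_mult_eq)
  then obtain c where "t = [:c:]" by (auto elim: degree_eq_zeroE)
  hence "P n = smult c q" "c \<noteq> 0" using t \<open>t \<noteq> 0\<close> by auto
  moreover have "S \<subseteq> {-1<..<1}" using S(2) by auto
  ultimately show ?thesis using that[of S c] S(1) \<open>card S = n\<close> op[of n] unfolding J q_def by blast
qed


text \<open>Writing \<open>p = c * (X - r) * q\<close>, the derivatives at \<open>r\<close> are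
  \<open>c * q(r)\<close> and \<open>2 * c * q'(r)\<close>, and \<open>q' / q\<close> is the sum of
  the reciprocals.\<close>

lemma pderiv2_at_simple_root:
  fixes c :: real
  assumes S: "finite S" and r: "r \<in> S" and c: "c \<noteq> 0"
  defines "p \<equiv> smult c (\<Prod>s\<in>S. [:-s, 1:])"
  shows "poly (pderiv p) r \<noteq> 0" 
    "poly (pderiv (pderiv p)) r = 2 * poly (pderiv p) r * (\<Sum>s\<in>S-{r}. 1 / (r - s))"
proof -
  define q where "q = (\<Prod>s\<in>S-{r}. [:-s, 1:])"
  have p: "p = smult c ([:-r, 1:] * q)" unfolding p_def q_def prod.remove[OF S r] ..
  have l: "pderiv [:-r, 1:] = 1" by (simp add: pderiv_pCons)
  have d1: "pderiv p = smult c (q + [:-r, 1:] * pderiv q)"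
    unfolding p pderiv_smult pderiv_mult l by (simp only: mult_1_right add.commute)
  have d2: "pderiv (pderiv p) = smult c (pderiv q + pderiv q + [:-r, 1:] * pderiv (pderiv q))"
    unfolding d1 pderiv_smult pderiv_mult pderiv_add l by (simp only: mult_1_left mult_1_right ac_simps)
  have q: "poly q r \<noteq> 0" unfolding q_def using S by (auto simp: poly_prod)
  have d1r: "poly (pderiv p) r = c * poly q r" unfolding d1 by simp
  thus "poly (pderiv p) r \<noteq> 0" using q c by simp
  have "poly (pderiv q) r = (\<Sum>s\<in>S-{r}. poly (\<Prod>t\<in>S-{r}-{s}. [:-t, 1:]) r)"
    unfolding q_def pderiv_prod by (simp add: poly_sum pderiv_pCons)
  also have "\<dots> = (\<Sum>s\<in>S-{r}. poly q r * (1 / (r - s)))"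
  proof (rule sum.cong)
    fix s assume s: "s \<in> S - {r}"
    have "q = [:-s, 1:] * (\<Prod>t\<in>S-{r}-{s}. [:-t, 1:])"
      unfolding q_def using S s by (intro prod.remove) auto
    hence "poly q r = poly [:-s, 1:] r * poly (\<Prod>t\<in>S-{r}-{s}. [:-t, 1:]) r"
      by (metis poly_mult)
    hence "poly q r = (r - s) * poly (\<Prod>t\<in>S-{r}-{s}. [:-t, 1:]) r" by simp
    thus "poly (\<Prod>t\<in>S-{r}-{s}. [:-t, 1:]) r = poly q r * (1 / (r - s))" using s by auto
  qed auto
  finally show "poly (pderiv (pderiv p)) r = 2 * poly (pderiv p) r * (\<Sum>s\<in>S-{r}. 1 / (r - s))"
    unfolding d1r unfolding d2 by (simp only: sum_distrib_left[symmetric]) simp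
qed

text \<open>At a root the right-hand side of the eigenvalue equation disappears, and the quotient of
  second and first derivative is twice the sum over the other roots. Passing from \<open>r\<close>
  to \<open>xs ! i = 2 * r\<close> rescales both sides by the same factor.\<close>

lemma jacobi_scaled_roots_stieltjes:
  fixes g d :: real and n :: nat
  assumes gd: "g > -1" "d > -1"
  defines "xs \<equiv> jacobi_scaled_roots g d n"
  shows "length xs = n" "sorted_wrt (<) xs"
    "\<And>i. i < n \<Longrightarrow> \<bar>xs ! i\<bar> < 2"
    "\<And>i. i < n \<Longrightarrow> 2 * (\<Sum>j\<in>{..<n}-{i}. 1 / (xs ! i - xs ! j)) = (g + 1) / (2 - xs ! i) - (d + 1) / (2 + xs ! i)"
proof -
  define P where "P = jacobi_poly g d n"
  obtain S c where S: "finite S" "card S = n" "S \<subseteq> {-1<..<1}" "c \<noteq> 0"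
    and P: "P = smult c (\<Prod>r\<in>S. [:-r, 1:])"
    and op: "jacobi_op g d P = smult (- (real n * (real n + g + d + 1))) P"
    using jacobi_poly_factor[OF gd, of n] unfolding P_def by metis
  have root: "poly P y = 0 \<longleftrightarrow> y \<in> S" for y unfolding P using S by (auto simp: poly_prod)
  have "{x. poly P (x / 2) = 0} = (\<lambda>y. 2 * y) ` S"
    unfolding root by (auto simp: image_iff intro!: bexI[of _ "x / 2" for x])
  hence xs: "xs = sorted_list_of_set ((\<lambda>y. 2 * y) ` S)"
    unfolding xs_def jacobi_scaled_roots_def P_def[symmetric] by simp
  have fin: "finite ((\<lambda>y. 2 * y) ` S)" using S by auto
  have card: "card ((\<lambda>y. 2 * y) ` S) = n" using S by (subst card_image) (auto simp: inj_on_def)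
  show len: "length xs = n" unfolding xs using card by simp
  show sw: "sorted_wrt (<) xs" unfolding xs by (rule strict_sorted_list_of_set)
  have set: "set xs = (\<lambda>y. 2 * y) ` S" and dist: "distinct xs" unfolding xs using fin by auto
  have inS: "xs ! i / 2 \<in> S" if "i < n" for i
    using nth_mem[of i xs] that len unfolding set by auto
  show b: "\<bar>xs ! i\<bar> < 2" if "i < n" for i using inS[OF that] S(3) by (auto simp: abs_less_iff)
  fix i assume i: "i < n"
  define r where "r = xs ! i / 2"
  have r: "r \<in> S" "-1 < r" "r < 1" using inS[OF i] S(3) unfolding r_def by auto
  have "inj_on (\<lambda>j. xs ! j / 2) ({..<n} - {i})"
    using dist len by (auto simp: inj_on_def nth_eq_iff_index_eq)
  moreover have "(\<lambda>j. xs ! j / 2) ` ({..<n} - {i}) = S - {r}"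
  proof (intro equalityI subsetI)
    fix y assume "y \<in> S - {r}"
    hence "2 * y \<in> set xs" "2 * y \<noteq> xs ! i" unfolding set r_def by auto
    then obtain j where "j < n" "xs ! j = 2 * y" "j \<noteq> i" using len by (metis in_set_conv_nth)
    thus "y \<in> (\<lambda>j. xs ! j / 2) ` ({..<n} - {i})" by (auto intro!: image_eqI[of _ _ j])
  next
    fix y assume "y \<in> (\<lambda>j. xs ! j / 2) ` ({..<n} - {i})"
    thus "y \<in> S - {r}" using inS i dist len unfolding r_def by (auto simp: nth_eq_iff_index_eq)
  qed
  ultimately have "(\<Sum>s\<in>S-{r}. 1 / (r - s)) = (\<Sum>j\<in>{..<n}-{i}. 1 / (r - xs ! j / 2))"
    by (metis (no_types, lifting) sum.reindex_cong)
  also have "\<dots> = 2 * (\<Sum>j\<in>{..<n}-{i}. 1 / (xs ! i - xs ! j))"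
    unfolding r_def sum_distrib_left by (intro sum.cong) (auto simp: diff_divide_distrib[symmetric])
  finally have sum_eq: "(\<Sum>s\<in>S-{r}. 1 / (r - s)) = 2 * (\<Sum>j\<in>{..<n}-{i}. 1 / (xs ! i - xs ! j))" .
  have "(1 - r\<^sup>2) * poly (pderiv (pderiv P)) r + (d - g - (g + d + 2) * r) * poly (pderiv P) r = 0"
    using arg_cong[OF op, of "\<lambda>p. poly p r"] root[of r] r unfolding jacobi_op_def
    by (simp add: algebra_simps power2_eq_square)
  moreover have nz: "poly (pderiv P) r \<noteq> 0"
    and "poly (pderiv (pderiv P)) r = 2 * poly (pderiv P) r * (\<Sum>s\<in>S-{r}. 1 / (r - s))"
    using pderiv2_at_simple_root[OF S(1) r(1) S(4)] unfolding P by auto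
  ultimately have "poly (pderiv P) r * ((1 - r\<^sup>2) * (2 * (\<Sum>s\<in>S-{r}. 1 / (r - s))) + (d - g - (g + d + 2) * r)) = 0"
    by (simp add: algebra_simps)
  hence e: "(1 - r\<^sup>2) * (2 * (\<Sum>s\<in>S-{r}. 1 / (r - s))) = (g + 1) * (1 + r) - (d + 1) * (1 - r)"
    using nz unfolding mult_eq_0_iff by (simp add: algebra_simps)
  have "1 - r\<^sup>2 = (1 - r) * (1 + r)" by (simp add: algebra_simps power2_eq_square)
  moreover have "X = a / u - b / v" if "u * v * X = a * v - b * u" "u \<noteq> 0" "v \<noteq> 0" for X a b u v :: real
    using that by (simp add: divide_simps) (simp add: algebra_simps)
  ultimately have "2 * (\<Sum>s\<in>S-{r}. 1 / (r - s)) = (g + 1) / (1 - r) - (d + 1) / (1 + r)"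
    using e r by simp
  moreover have "(g + 1) / (1 - r) = 2 * ((g + 1) / (2 - xs ! i))" "(d + 1) / (1 + r) = 2 * ((d + 1) / (2 + xs ! i))"
    using r unfolding r_def by (auto simp: field_simps)
  ultimately show "2 * (\<Sum>j\<in>{..<n}-{i}. 1 / (xs ! i - xs ! j)) = (g + 1) / (2 - xs ! i) - (d + 1) / (2 + xs ! i)"
    unfolding sum_eq by linarith
qed

subsection \<open>Integration by parts\<close>

lemma has_real_derivative_abs_powr:
  fixes u c p :: real
  assumes "u \<noteq> c"
  shows "((\<lambda>u. \<bar>u - c\<bar> powr p) has_real_derivative \<bar>u - c\<bar> powr p * (p / (u - c))) (at u)"
proof (cases "u > c")
  case True
  have "((\<lambda>u. (u - c) powr p) has_real_derivative (u - c) powr p * (p / (u - c))) (at u)"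
    using True by (auto intro!: derivative_eq_intros simp: powr_diff)
  moreover have "\<forall>\<^sub>F x in nhds u. x > c" using True by (intro order_tendstoD) (auto simp: filterlim_ident)
  hence "\<forall>\<^sub>F x in nhds u. (x - c) powr p = \<bar>x - c\<bar> powr p" by eventually_elim auto
  ultimately show ?thesis using True by (subst (asm) DERIV_cong_ev[OF refl _ refl]) auto
next
  case False
  hence c: "u < c" using assms by auto
  have "((\<lambda>u. (c - u) powr p) has_real_derivative (c - u) powr p * (p / (u - c))) (at u)"
    using c by (auto intro!: derivative_eq_intros simp: powr_diff divide_simps) (simp add: algebra_simps)
  moreover have "\<forall>\<^sub>F x in nhds u. x < c" using c by (intro order_tendstoD) (auto simp: filterlim_ident)
  hence "\<forall>\<^sub>F x in nhds u. (c - x) powr p = \<bar>x - c\<bar> powr p" by eventually_elim auto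
  ultimately show ?thesis using c by (subst (asm) DERIV_cong_ev[OF refl _ refl]) auto
qed

lemma has_real_derivative_prod_abs_powr:
  fixes y :: "'a \<Rightarrow> real"
  assumes "finite J" "u \<notin> y ` J"
  shows "((\<lambda>u. \<Prod>j\<in>J. \<bar>u - y j\<bar> powr p) has_real_derivative
     (\<Prod>j\<in>J. \<bar>u - y j\<bar> powr p) * (p * (\<Sum>j\<in>J. 1 / (u - y j)))) (at u)"
  using assms
proof (induction rule: finite_induct)
  case (insert j J)
  hence ne: "u \<noteq> y j" by auto
  have IH: "((\<lambda>u. \<Prod>j\<in>J. \<bar>u - y j\<bar> powr p) has_real_derivative
     (\<Prod>j\<in>J. \<bar>u - y j\<bar> powr p) * (p * (\<Sum>j\<in>J. 1 / (u - y j)))) (at u)"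
    using insert by auto
  have e: "X * (p / z) * Y + Y * (p * S) * X = X * Y * (p * (1 / z + S))" for X Y S z :: real
    by (simp add: algebra_simps)
  show ?case
    using DERIV_mult[OF has_real_derivative_abs_powr[OF ne, of p] IH] unfolding e
    by (simp only: prod.insert[OF insert(1,2)] sum.insert[OF insert(1,2)])
qed auto

lemma eventually_card_less_const:
  fixes y :: "'a \<Rightarrow> real"
  assumes "finite J" "u \<notin> y ` J"
  shows "\<forall>\<^sub>F v in nhds u. card {j\<in>J. y j < v} = card {j\<in>J. y j < u}"
proof -
  have "\<forall>\<^sub>F v in nhds u. \<forall>j\<in>J. (y j < v) = (y j < u)"
  proof (intro eventually_ball_finite[OF assms(1)] ballI)
    fix j assume "j \<in> J"
    hence "y j < u \<or> u < y j" using assms by force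
    thus "\<forall>\<^sub>F v in nhds u. (y j < v) = (y j < u)"
    proof
      assume c: "y j < u"
      hence "\<forall>\<^sub>F x in nhds u. x > y j" by (intro order_tendstoD) (auto simp: filterlim_ident)
      thus ?thesis by eventually_elim (use c in auto)
    next
      assume c: "u < y j"
      hence "\<forall>\<^sub>F x in nhds u. x < y j" by (intro order_tendstoD) (auto simp: filterlim_ident)
      thus ?thesis by eventually_elim (use c in auto)
    qed
  qed
  thus ?thesis by eventually_elim (intro arg_cong[where f = card], auto)
qed

definition jacobi_kernel :: "real \<Rightarrow> real \<Rightarrow> real \<Rightarrow> real" where
  "jacobi_kernel a b u = (2 - u) powr a * (2 + u) powr b * indicator {-2<..<2} u"

text \<open>The integrand is the derivative of \<open>\<phi> (r u) u\<close> times
  \<open>4 - u\<^sup>2\<close> times the density as a function of one coordinate. The boundary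
  values vanish since \<open>a + 1\<close> and \<open>b + 1\<close> are positive.
  \<open>\<phi>\<close> is indexed by \<open>r u\<close>, the number of particles to the left of
  \<open>u\<close>, because the rank of a particle selects its target.\<close>

lemma has_integral_drift_term:
  fixes \<phi> \<phi>' :: "nat \<Rightarrow> real \<Rightarrow> real" and y :: "'a \<Rightarrow> real"
  assumes ab: "a > -1" "b > -1" and \<beta>: "\<beta> > 0" and J: "finite J"
    and \<phi>: "\<And>k u. (\<phi> k has_real_derivative \<phi>' k u) (at u)"
  defines "r \<equiv> \<lambda>u. card {j\<in>J. y j < u}"
  shows "((\<lambda>u. jacobi_kernel a b u * (\<Prod>j\<in>J. \<bar>u - y j\<bar> powr \<beta>) * 
      ((4 - u\<^sup>2) * \<phi>' (r u) u + \<phi> (r u) u *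
         (\<beta> * (\<Sum>j\<in>J. (4 - u\<^sup>2) / (u - y j)) - (a+1) * (2 + u) + (b+1) * (2 - u)))) has_integral 0) {-2..2}"
    (is "(?g has_integral 0) _")
proof -
  define V where "V = (\<lambda>u. \<Prod>j\<in>J. \<bar>u - y j\<bar> powr \<beta>)"
  define T where "T = (\<lambda>u. (2 - u) powr (a+1) * (2 + u) powr (b+1) * V u)"
  define \<Psi> where "\<Psi> = (\<lambda>u. \<phi> (r u) u * T u)"
  have cont\<phi>: "continuous_on {-2..2} (\<phi> k)" for k
    using \<phi> by (intro continuous_at_imp_continuous_on ballI DERIV_isCont) auto
  have contT: "continuous_on {-2..2} T"
    unfolding T_def V_def using ab \<beta> by (intro continuous_intros continuous_on_powr') auto
  have r_le: "r u \<le> card J" for u unfolding r_def using J by (intro card_mono) auto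
  have "\<exists>C. \<forall>u\<in>{-2..2}. \<bar>\<phi> k u\<bar> \<le> C" for k
    using compact_imp_bounded[OF compact_continuous_image[OF cont\<phi>[of k]]] by (force simp: bounded_iff)
  then obtain C where C: "\<And>k u. u \<in> {-2..2} \<Longrightarrow> \<bar>\<phi> k u\<bar> \<le> C k" by metis
  define D where "D = (\<Sum>k\<le>card J. \<bar>C k\<bar>)"
  have D: "\<bar>\<phi> (r u) u\<bar> \<le> D" if "u \<in> {-2..2}" for u
  proof -
    have "\<bar>\<phi> (r u) u\<bar> \<le> \<bar>C (r u)\<bar>" using C[OF that, of "r u"] by auto
    also have "\<dots> \<le> D" unfolding D_def using r_le[of u] by (intro member_le_sum) auto
    finally show ?thesis .
  qed
  \<comment> \<open>The rank jumps when \<open>u\<close> crosses some \<open>y j\<close>, but \<open>T\<close> vanishes there since \<open>\<beta> > 0\<close>.\<close>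
  have cont: "continuous_on {-2..2} \<Psi>"
    unfolding continuous_on_def
  proof
    fix u :: real assume u: "u \<in> {-2..2}"
    have limT: "(T \<longlongrightarrow> T u) (at u within {-2..2})" using contT u by (auto simp: continuous_on_def)
    show "(\<Psi> \<longlongrightarrow> \<Psi> u) (at u within {-2..2})"
    proof (cases "T u = 0")
      case True
      have "((\<lambda>v. D * T v) \<longlongrightarrow> D * 0) (at u within {-2..2})"
        using limT True by (intro tendsto_intros) auto
      hence l: "((\<lambda>v. D * T v) \<longlongrightarrow> 0) (at u within {-2..2})" by simp
      have "(\<Psi> \<longlongrightarrow> 0) (at u within {-2..2})"
      proof (rule Lim_null_comparison[OF _ l])
        show "\<forall>\<^sub>F v in at u within {-2..2}. norm (\<Psi> v) \<le> D * T v"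
          unfolding eventually_at_filter
        proof (intro always_eventually allI impI)
          fix v :: real assume v: "v \<in> {-2..2}"
          have "T v \<ge> 0" unfolding T_def V_def by (intro mult_nonneg_nonneg prod_nonneg) auto
          thus "norm (\<Psi> v) \<le> D * T v" unfolding \<Psi>_def using D[OF v] by (auto simp: abs_mult intro!: mult_right_mono)
        qed
      qed
      thus ?thesis unfolding \<Psi>_def True by simp
    next
      case False
      hence "u \<notin> y ` J" unfolding T_def V_def using J \<beta> by auto
      from eventually_card_less_const[OF J this]
      have ev: "\<forall>\<^sub>F v in at u within {-2..2}. \<phi> (r u) v * T v = \<Psi> v"
        unfolding r_def \<Psi>_def eventually_at_filter by eventually_elim auto
      have "((\<lambda>v. \<phi> (r u) v * T v) \<longlongrightarrow> \<phi> (r u) u * T u) (at u within {-2..2})"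
        using cont\<phi>[of "r u"] u limT by (intro tendsto_intros) (auto simp: continuous_on_def)
      thus ?thesis using tendsto_cong[OF ev] unfolding \<Psi>_def by simp
    qed
  qed
  \<comment> \<open>For small \<open>\<beta>\<close> the derivative is unbounded at the points
    \<open>y j\<close>; this version of the theorem allows a finite exceptional set as long as the
    primitive is continuous.\<close>
  have "(?g has_integral (\<Psi> 2 - \<Psi> (-2))) {-2..2}"
  proof (rule fundamental_theorem_of_calculus_interior_strong[of "y ` J"])
    fix u :: real assume u: "u \<in> {-2<..<2} - y ` J"
    define k where "k = r u"
    define S where "S = (\<Sum>j\<in>J. 1 / (u - y j))"
    have p1: "(2 - u) powr (a+1) = (2 - u) * (2 - u) powr a" "(2 + u) powr (b+1) = (2 + u) * (2 + u) powr b"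
      using u by (auto simp: powr_add)
    have dV: "(V has_real_derivative V u * (\<beta> * S)) (at u)"
      unfolding V_def S_def using u by (intro has_real_derivative_prod_abs_powr J) auto
    have dP: "((\<lambda>u. (2 - u) powr (a+1) * (2 + u) powr (b+1)) has_real_derivative 
        (2 - u) powr a * (2 + u) powr b * ((b+1) * (2 - u) - (a+1) * (2 + u))) (at u)"
      using u by (auto intro!: derivative_eq_intros simp: p1[unfolded add.commute[of a] add.commute[of b]] p1) (simp add: algebra_simps)
    have dT: "(T has_real_derivative (2 - u) powr a * (2 + u) powr b * V u *
         ((4 - u\<^sup>2) * \<beta> * S - (a+1) * (2 + u) + (b+1) * (2 - u))) (at u)"
      using DERIV_mult[OF dP dV] unfolding T_def p1 by (simp add: algebra_simps power2_eq_square)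
    have T: "T u = (2 - u) powr a * (2 + u) powr b * V u * (4 - u\<^sup>2)"
      unfolding T_def p1 by (simp add: algebra_simps power2_eq_square)
    have "((\<lambda>v. \<phi> k v * T v) has_real_derivative (2 - u) powr a * (2 + u) powr b * V u * 
      ((4 - u\<^sup>2) * \<phi>' k u + \<phi> k u * (\<beta> * ((4 - u\<^sup>2) * S) - (a+1) * (2 + u) + (b+1) * (2 - u)))) (at u)"
      using DERIV_mult[OF \<phi>[of k u] dT] unfolding T by (simp add: algebra_simps)
    also have "(2 - u) powr a * (2 + u) powr b = jacobi_kernel a b u"
      unfolding jacobi_kernel_def using u by auto
    also have "(4 - u\<^sup>2) * S = (\<Sum>j\<in>J. (4 - u\<^sup>2) / (u - y j))"
      unfolding S_def sum_distrib_left by simp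
    finally have d: "((\<lambda>v. \<phi> k v * T v) has_real_derivative ?g u) (at u)"
      unfolding k_def V_def .
    have ev: "\<forall>\<^sub>F v in nhds u. \<phi> k v * T v = \<Psi> v"
      using eventually_card_less_const[OF J, of u y] u unfolding r_def \<Psi>_def k_def
      by (auto elim: eventually_mono)
    have "(\<Psi> has_real_derivative ?g u) (at u)"
      by (rule DERIV_cong_ev[OF refl ev refl, THEN iffD1, OF d])
    thus "(\<Psi> has_vector_derivative ?g u) (at u)" by (simp add: has_real_derivative_iff_has_vector_derivative)
  qed (use J cont in auto)
  moreover have "\<Psi> 2 = 0" "\<Psi> (-2) = 0" unfolding \<Psi>_def T_def using ab by auto
  ultimately show ?thesis by simp
qed

section \<open>The joint density: integrability and iterated integration\<close>

lemma jacobi_kernel_measurable [measurable]: "jacobi_kernel a b \<in> borel_measurable borel"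
  unfolding jacobi_kernel_def by measurable

lemma jacobi_kernel_nonneg: "0 \<le> jacobi_kernel a b u"
  unfolding jacobi_kernel_def by auto

lemma prod_kernel_eq_0:
  assumes "finite I" "k \<in> I" "l k \<notin> {-2<..<2}"
  shows "(\<Prod>k\<in>I. jacobi_kernel a b (l k)) = 0"
  using assms by (intro prod_zero[OF _ bexI[of _ k]]) (simp_all add: jacobi_kernel_def)

lemma jacobi_kernel_integrable:
  assumes "a > -1" "b > -1"
  shows "integrable lborel (jacobi_kernel a b)"
proof -
  have "(\<lambda>u. (2 - u) powr a * (2 + u) powr b) absolutely_integrable_on {-2..2}"
    using jacobi_weight_absolutely_integrable[of a b 2] assms by simp
  hence "integrable lebesgue (\<lambda>u. indicator {-2..2} u *\<^sub>R ((2 - u) powr a * (2 + u) powr b))"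
    unfolding set_integrable_def .
  also have "(\<lambda>u. indicator {-2..2} u *\<^sub>R ((2 - u) powr a * (2 + u) powr b)) = jacobi_kernel a b"
  proof
    fix u :: real
    \<comment> \<open>At the endpoints both sides are 0 even for negative exponents, because
      \<open>0 powr a = 0\<close>; hence the closed and the open indicator agree.\<close>
    show "indicator {-2..2} u *\<^sub>R ((2 - u) powr a * (2 + u) powr b) = jacobi_kernel a b u"
      unfolding jacobi_kernel_def by (cases "u = 2"; cases "u = -2") (auto simp: indicator_def)
  qed
  finally show ?thesis by (subst (asm) integrable_completion) auto
qed

lemma abs_powr_integrable:
  fixes p R :: real
  assumes "p > -1" "R \<ge> 0"
  shows "integrable lborel (\<lambda>s. \<bar>s\<bar> powr p * indicator {-R..R} s)"
proof -
  define k where "k = (\<lambda>s::real. s powr p * indicator {0..R} s)"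
  have "(\<lambda>s. s powr p) absolutely_integrable_on {0..R}"
    using integrable_on_powr_from_0[OF assms] by (intro nonnegative_absolutely_integrable_1) auto
  hence "integrable lebesgue k"
    unfolding set_integrable_def k_def by (simp add: mult.commute)
  moreover have [measurable]: "k \<in> borel_measurable borel" unfolding k_def by measurable
  ultimately have k: "integrable lborel k" by (subst (asm) integrable_completion) auto
  have k': "integrable lborel (\<lambda>s. k (0 + (-1) * s))"
    using lborel_integrable_real_affine[OF k, of "-1" 0] by simp
  have "integrable lborel (\<lambda>s. k s + k (0 + (-1) * s))"
    by (rule Bochner_Integration.integrable_add[OF k k'])
  also have "(\<lambda>s. k s + k (0 + (-1) * s)) = (\<lambda>s. \<bar>s\<bar> powr p * indicator {-R..R} s)"
    unfolding k_def by (auto simp: fun_eq_iff indicator_def abs_if)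
  finally show ?thesis .
qed

lemma prod_pairs_remove:
  fixes g :: "nat \<Rightarrow> nat \<Rightarrow> real"
  assumes i: "i < n" and sym: "\<And>p q. g p q = g q p"
  shows "(\<Prod>p<n. \<Prod>q\<in>{p<..<n}. g p q) =
    (\<Prod>j\<in>{..<n}-{i}. g i j) * (\<Prod>p\<in>{..<n}-{i}. \<Prod>q\<in>{p<..<n}-{i}. g p q)"
proof -
  have "(\<Prod>p<n. \<Prod>q\<in>{p<..<n}. g p q) = (\<Prod>q\<in>{i<..<n}. g i q) * (\<Prod>p\<in>{..<n}-{i}. \<Prod>q\<in>{p<..<n}. g p q)"
    using i by (intro prod.remove) auto
  \<comment> \<open>For \<open>p < i\<close> the pair of \<open>p\<close> and \<open>i\<close> sits
    in row \<open>p\<close>. It is pulled out there and reversed by symmetry, supplying the indices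
    below \<open>i\<close> in the first factor.\<close>
  also have "(\<Prod>p\<in>{..<n}-{i}. \<Prod>q\<in>{p<..<n}. g p q) =
     (\<Prod>p\<in>{..<n}-{i}. (if p < i then g p i else 1) * (\<Prod>q\<in>{p<..<n}-{i}. g p q))"
  proof (rule prod.cong)
    fix p assume "p \<in> {..<n}-{i}"
    show "(\<Prod>q\<in>{p<..<n}. g p q) = (if p < i then g p i else 1) * (\<Prod>q\<in>{p<..<n}-{i}. g p q)"
    proof (cases "p < i")
      case True
      thus ?thesis using i prod.remove[of "{p<..<n}" i "g p"] by simp
    qed simp
  qed simp
  also have "\<dots> = (\<Prod>p\<in>{..<n}-{i}. if p < i then g p i else 1) * (\<Prod>p\<in>{..<n}-{i}. \<Prod>q\<in>{p<..<n}-{i}. g p q)"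
    by (rule prod.distrib)
  also have "(\<Prod>p\<in>{..<n}-{i}. if p < i then g p i else 1) = (\<Prod>p<i. g i p)"
    using i by (intro prod.mono_neutral_cong_right) (auto simp: sym)
  also have "(\<Prod>q\<in>{i<..<n}. g i q) * ((\<Prod>p<i. g i p) * X) = (\<Prod>j\<in>{..<n}-{i}. g i j) * X" for X
  proof -
    have "{..<n} - {i} = {..<i} \<union> {i<..<n}" using i by auto
    moreover have "(\<Prod>j\<in>{..<i} \<union> {i<..<n}. g i j) = (\<Prod>p<i. g i p) * (\<Prod>q\<in>{i<..<n}. g i q)"
      by (rule prod.union_disjoint) auto
    ultimately show ?thesis by simp
  qed
  finally show ?thesis .
qed

text \<open>The pairs avoiding index \<open>i\<close>, which stay constant while \<open>l i\<close>
  is integrated.\<close>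

definition vandermonde_rest :: "nat \<Rightarrow> real \<Rightarrow> nat \<Rightarrow> (nat \<Rightarrow> real) \<Rightarrow> real" where
  "vandermonde_rest n \<beta> i l = (\<Prod>p\<in>{..<n}-{i}. \<Prod>q\<in>{p<..<n}-{i}. \<bar>l p - l q\<bar> powr \<beta>)"

lemma jacobi_ens_weight_split:
  assumes i: "i < n"
  shows "jacobi_ens_weight n a b \<beta> l = 
    vandermonde_rest n \<beta> i l * (\<Prod>k\<in>{..<n}-{i}. jacobi_kernel a b (l k)) *
    (jacobi_kernel a b (l i) * (\<Prod>j\<in>{..<n}-{i}. \<bar>l i - l j\<bar> powr \<beta>))"
proof -
  have "(\<Prod>p<n. \<Prod>q\<in>{p<..<n}. \<bar>l p - l q\<bar> powr \<beta>) = (\<Prod>j\<in>{..<n}-{i}. \<bar>l i - l j\<bar> powr \<beta>) * vandermonde_rest n \<beta> i l"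
    unfolding vandermonde_rest_def by (intro prod_pairs_remove i) (simp add: abs_minus_commute)
  moreover have "(\<Prod>k<n. jacobi_kernel a b (l k)) = jacobi_kernel a b (l i) * (\<Prod>k\<in>{..<n}-{i}. jacobi_kernel a b (l k))"
    using i by (intro prod.remove) auto
  ultimately show ?thesis
    unfolding jacobi_ens_weight_def jacobi_kernel_def[symmetric] by simp
qed

lemma jacobi_ens_weight_eq_0:
  assumes "k < n" "l k \<notin> {-2<..<2}"
  shows "jacobi_ens_weight n a b \<beta> l = 0"
  using prod_kernel_eq_0[of "{..<n}" k l a b] assms
  unfolding jacobi_ens_weight_def jacobi_kernel_def[symmetric] by simp

lemma jacobi_ens_weight_nonneg: "0 \<le> jacobi_ens_weight n a b \<beta> l"
  unfolding jacobi_ens_weight_def by (intro mult_nonneg_nonneg prod_nonneg) auto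

lemma jacobi_ens_weight_measurable [measurable]:
  "jacobi_ens_weight n a b \<beta> \<in> borel_measurable (PiM {..<n} (\<lambda>_. lborel))"
  unfolding jacobi_ens_weight_def[abs_def] by measurable

lemma component_measurable:
  assumes "k \<in> I"
  shows "(\<lambda>l. l k) \<in> borel_measurable (PiM I (\<lambda>_. lborel :: real measure))"
  using measurable_component_singleton[OF assms, of "\<lambda>_. lborel :: real measure"] by simp

lemma prod_kernel_integrable:
  assumes "a > -1" "b > -1" "finite I"
  shows "integrable (PiM I (\<lambda>_. lborel)) (\<lambda>l. \<Prod>k\<in>I. jacobi_kernel a b (l k))"
proof -
  interpret product_sigma_finite "\<lambda>_. lborel :: real measure" ..
  show ?thesis using assms by (intro product_integrable_prod jacobi_kernel_integrable)
qed

text \<open>Integrating \<open>l i\<close> first gives a bound uniform in the other coordinates: on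
  the support \<open>\<bar>l i - l j\<bar> < 4\<close>, and translating by \<open>l j\<close> moves
  the singularity to 0, where the exponent \<open>\<beta> - 1\<close> exceeds -1.\<close>

lemma singular_pair_integrable:
  fixes n i j :: nat
  assumes ab: "a > -1" "b > -1" and \<beta>: "\<beta> > 0" and ij: "i < n" "j < n" "i \<noteq> j"
  shows "integrable (PiM {..<n} (\<lambda>_. lborel)) 
    (\<lambda>l. \<bar>l i - l j\<bar> powr (\<beta> - 1) * indicator {-2<..<2} (l i) * (\<Prod>k\<in>{..<n}-{i}. jacobi_kernel a b (l k)))"
    (is "integrable ?M ?f")
proof (rule integrableI_bounded)
  interpret product_sigma_finite "\<lambda>_. lborel :: real measure" ..
  define h where "h = (\<lambda>s::real. \<bar>s\<bar> powr (\<beta> - 1) * indicator {-4..4} s)"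
  have h: "integrable lborel h" unfolding h_def using \<beta> by (intro abs_powr_integrable) auto
  have h0: "h s \<ge> 0" for s unfolding h_def by auto
  have [measurable]: "(\<lambda>l. l i) \<in> borel_measurable ?M" "(\<lambda>l. l j) \<in> borel_measurable ?M"
    using ij by (auto intro: component_measurable)
  have [measurable]: "(\<lambda>l. \<Prod>k\<in>{..<n}-{i}. jacobi_kernel a b (l k)) \<in> borel_measurable ?M"
    by (intro borel_measurable_prod measurable_compose[OF component_measurable jacobi_kernel_measurable]) auto
  show m: "?f \<in> borel_measurable ?M" by measurable
  have ins: "insert i ({..<n}-{i}) = {..<n}" using ij by auto
  let ?N = "PiM ({..<n}-{i}) (\<lambda>_. lborel :: real measure)"
  let ?K = "\<lambda>y. \<Prod>k\<in>{..<n}-{i}. jacobi_kernel a b (y k)"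
  have K0: "?K y \<ge> 0" for y by (intro prod_nonneg) (auto simp: jacobi_kernel_nonneg)
  have "(\<integral>\<^sup>+l. ennreal (norm (?f l)) \<partial>?M) = (\<integral>\<^sup>+y. (\<integral>\<^sup>+u. ennreal (norm (?f (y(i := u)))) \<partial>lborel) \<partial>?N)"
    by (rule product_nn_integral_insert[of "{..<n}-{i}" i "\<lambda>l. ennreal (norm (?f l))", unfolded ins]) (use m in auto)
  also have "\<dots> \<le> (\<integral>\<^sup>+y. ennreal (integral\<^sup>L lborel h) * ennreal (?K y) \<partial>?N)"
  proof (rule nn_integral_mono)
    fix y
    have upd: "?f (y(i := u)) = \<bar>u - y j\<bar> powr (\<beta> - 1) * indicator {-2<..<2} u * ?K y" for u
      using ij by (auto intro!: prod.cong)
    have "(\<integral>\<^sup>+u. ennreal (norm (?f (y(i := u)))) \<partial>lborel) \<le> (\<integral>\<^sup>+u. ennreal (h (u - y j)) * ennreal (?K y) \<partial>lborel)"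
    proof (rule nn_integral_mono)
      fix u
      have "norm (?f (y(i := u))) \<le> h (u - y j) * ?K y"
      proof (cases "y j \<in> {-2<..<2}")
        case True
        thus ?thesis unfolding upd h_def using K0[of y]
          by (auto simp: abs_mult indicator_def intro!: mult_right_mono)
      next
        case False
        hence K: "?K y = 0" using ij by (intro prod_kernel_eq_0[of _ j]) auto
        show ?thesis unfolding upd K by simp
      qed
      thus "ennreal (norm (?f (y(i := u)))) \<le> ennreal (h (u - y j)) * ennreal (?K y)"
        using h0 K0 by (simp add: ennreal_mult[symmetric] ennreal_leI)
    qed
    also have "\<dots> = (\<integral>\<^sup>+u. ennreal (h (u - y j)) \<partial>lborel) * ennreal (?K y)"
      using h by (intro nn_integral_multc) auto
    also have "(\<integral>\<^sup>+u. ennreal (h (u - y j)) \<partial>lborel) = (\<integral>\<^sup>+u. ennreal (h u) \<partial>lborel)"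
      using nn_integral_real_affine[of "\<lambda>u. ennreal (h u)" 1 "- y j"] h by (simp add: algebra_simps)
    also have "\<dots> = ennreal (integral\<^sup>L lborel h)"
      using h h0 by (intro nn_integral_eq_integral) auto
    finally show "(\<integral>\<^sup>+u. ennreal (norm (?f (y(i := u)))) \<partial>lborel) \<le> ennreal (integral\<^sup>L lborel h) * ennreal (?K y)" .
  qed
  also have "\<dots> = ennreal (integral\<^sup>L lborel h) * (\<integral>\<^sup>+y. ennreal (?K y) \<partial>?N)"
    by (intro nn_integral_cmult measurable_compose[OF _ measurable_ennreal]
        borel_measurable_integrable prod_kernel_integrable ab) auto
  also have "(\<integral>\<^sup>+y. ennreal (?K y) \<partial>?N) = ennreal (integral\<^sup>L ?N ?K)"
    using prod_kernel_integrable[OF ab, of "{..<n}-{i}"] K0 by (intro nn_integral_eq_integral) auto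
  finally show "(\<integral>\<^sup>+l. ennreal (norm (?f l)) \<partial>?M) < \<infinity>"
    by (simp add: ennreal_mult_less_top order_le_less_trans)
qed

text \<open>For distinct coordinates this is the position of \<open>l i\<close> in the sorted list,
  counted from 0 as in \<open>order_stat\<close>.\<close>

definition rank_of :: "nat \<Rightarrow> (nat \<Rightarrow> real) \<Rightarrow> nat \<Rightarrow> nat" where
  "rank_of n l i = card {j\<in>{..<n}. l j < l i}"

lemma rank_of_less: "i < n \<Longrightarrow> rank_of n l i < n"
proof -
  assume "i < n"
  hence "{j\<in>{..<n}. l j < l i} \<subset> {..<n}" by auto
  from psubset_card_mono[OF _ this] show ?thesis unfolding rank_of_def by simp
qed

lemma rank_of_measurable [measurable]:
  assumes "i < n"
  shows "(\<lambda>l. rank_of n l i) \<in> PiM {..<n} (\<lambda>_. lborel) \<rightarrow>\<^sub>M count_space UNIV"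
proof -
  have [measurable]: "(\<lambda>l. l j) \<in> borel_measurable (PiM {..<n} (\<lambda>_. lborel :: real measure))" if "j \<in> {..<n}" for j
    using that by (rule component_measurable)
  have "rank_of n l i = (\<Sum>j\<in>{..<n}. if l j < l i then 1 else 0)" for l
    unfolding rank_of_def by (simp add: sum.If_cases Int_def)
  moreover have "(\<lambda>l. \<Sum>j\<in>{..<n}. if l j < l i then 1 else (0::nat)) \<in> PiM {..<n} (\<lambda>_. lborel :: real measure) \<rightarrow>\<^sub>M count_space UNIV"
    using assms by (intro measurable_sum_nat) measurable
  ultimately show ?thesis by simp
qed

text \<open>The density times the integrand of the integration by parts in coordinate
  \<open>i\<close>, with the test function selected by the rank of that coordinate.\<close>

definition drift_term ::
  "nat \<Rightarrow> real \<Rightarrow> real \<Rightarrow> real \<Rightarrow> (nat \<Rightarrow> real \<Rightarrow> real) \<Rightarrow> (nat \<Rightarrow> real \<Rightarrow> real) \<Rightarrow> nat \<Rightarrow> (nat \<Rightarrow> real) \<Rightarrow> real" where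
  "drift_term n a b \<beta> \<phi> \<phi>' i l = jacobi_ens_weight n a b \<beta> l *
     ((4 - (l i)\<^sup>2) * \<phi>' (rank_of n l i) (l i) + \<phi> (rank_of n l i) (l i) * drift {..<n} \<beta> (a+1) (b+1) l i)"

lemma rank_dependent_measurable:
  fixes f :: "nat \<Rightarrow> real \<Rightarrow> real"
  assumes i: "i < n" and f: "\<And>k. continuous_on UNIV (f k)"
  shows "(\<lambda>l. f (rank_of n l i) (l i)) \<in> borel_measurable (PiM {..<n} (\<lambda>_. lborel))"
proof (rule measurable_compose_countable[OF _ rank_of_measurable[OF i]])
  fix k
  have "(\<lambda>l. l i) \<in> borel_measurable (PiM {..<n} (\<lambda>_. lborel :: real measure))"
    using i by (intro component_measurable) auto
  thus "(\<lambda>l. f k (l i)) \<in> borel_measurable (PiM {..<n} (\<lambda>_. lborel))"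
    by (rule measurable_compose[OF _ borel_measurable_continuous_onI[OF f]])
qed

lemma drift_term_measurable [measurable]:
  assumes i: "i < n" and \<phi>: "\<And>k. continuous_on UNIV (\<phi> k)" "\<And>k. continuous_on UNIV (\<phi>' k)"
  shows "drift_term n a b \<beta> \<phi> \<phi>' i \<in> borel_measurable (PiM {..<n} (\<lambda>_. lborel))"
proof -
  let ?M = "PiM {..<n} (\<lambda>_. lborel :: real measure)"
  have c: "(\<lambda>l. l j) \<in> borel_measurable ?M" if "j \<in> {..<n}" for j
    using that by (rule component_measurable)
  have ci [measurable]: "(\<lambda>l. l i) \<in> borel_measurable ?M" using i by (intro c) auto
  have [measurable]: "(\<lambda>l. \<phi> (rank_of n l i) (l i)) \<in> borel_measurable ?M" "(\<lambda>l. \<phi>' (rank_of n l i) (l i)) \<in> borel_measurable ?M"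
    by (intro rank_dependent_measurable i \<phi>)+
  have [measurable]: "(\<lambda>l. \<Sum>j\<in>{..<n}-{i}. (4 - (l i)\<^sup>2) / (l i - l j)) \<in> borel_measurable ?M"
    by (intro borel_measurable_sum borel_measurable_divide borel_measurable_diff c) (use i in auto)
  show ?thesis unfolding drift_term_def[abs_def] drift_def by measurable
qed

lemma kernel_times_square_le:
  assumes "a > -1" "b > -1"
  shows "(4 - u\<^sup>2) * jacobi_kernel a b u \<le> 4 powr (a + 1) * 4 powr (b + 1) * indicator {-2<..<2} u"
proof (cases "u \<in> {-2<..<2}")
  case True
  have "(4 - u\<^sup>2) * jacobi_kernel a b u = (2 - u) powr (a + 1) * (2 + u) powr (b + 1)"
    using True unfolding jacobi_kernel_def by (simp add: powr_add algebra_simps power2_eq_square)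
  also have "\<dots> \<le> 4 powr (a + 1) * 4 powr (b + 1)"
    using True assms by (intro mult_mono powr_mono2) auto
  finally show ?thesis using True by simp
qed (simp add: jacobi_kernel_def)

text \<open>
  The factor \<open>4 - u\<^sup>2\<close> compensates the singularity of the weight in the differentiated variable, so that
  only the integrable singularity \<open>\<bar>l i - l j\<bar> powr (\<beta> - 1)\<close> is left.
\<close>

lemma drift_term_bound:
  assumes ab: "a > -1" "b > -1" and \<beta>: "\<beta> > 0" and i: "i < n"
    and C: "\<And>k u. k < n \<Longrightarrow> u \<in> {-2..2} \<Longrightarrow> \<bar>\<phi> k u\<bar> \<le> C" "\<And>k u. k < n \<Longrightarrow> u \<in> {-2..2} \<Longrightarrow> \<bar>\<phi>' k u\<bar> \<le> C"
  shows "\<exists>D. \<forall>l. \<bar>drift_term n a b \<beta> \<phi> \<phi>' i l\<bar> \<le> D * ((\<Prod>k<n. jacobi_kernel a b (l k)) +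
     (\<Sum>j\<in>{..<n}-{i}. \<bar>l i - l j\<bar> powr (\<beta> - 1) * indicator {-2<..<2} (l i) * (\<Prod>k\<in>{..<n}-{i}. jacobi_kernel a b (l k))))"
proof -
  define L where "L = (4::real) powr \<beta>"
  have L1: "L \<ge> 1" unfolding L_def using \<beta> by (simp add: ge_one_powr_ge_zero)
  define R where "R = (\<Prod>p\<in>{..<n}-{i}. \<Prod>q\<in>{p<..<n}-{i}. L)"
  have R0: "R \<ge> 0" unfolding R_def using L1 by (intro prod_nonneg) auto
  define P where "P = (\<Prod>j\<in>{..<n}-{i}. L)"
  have P1: "P \<ge> 1" unfolding P_def using L1 by (intro prod_ge_1) auto
  define E where "E = (4::real) powr (a + 1) * 4 powr (b + 1)"
  have E0: "E \<ge> 0" unfolding E_def by simp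
  have C0: "C \<ge> 0" using C(1)[of 0 0] i by force
  \<comment> \<open>\<open>D1\<close> accounts for the derivative of the test function and the
    confining force, \<open>D2\<close> for the repulsion.\<close>
  define D1 where "D1 = R * P * (4 * C + C * (4 * (a + 1) + 4 * (b + 1)))"
  define D2 where "D2 = R * P * C * \<beta> * E"
  have D: "D1 \<ge> 0" "D2 \<ge> 0" unfolding D1_def D2_def using R0 P1 C0 ab \<beta> E0 by auto
  show ?thesis
  proof (intro exI[of _ "D1 + D2"] allI)
    fix l :: "nat \<Rightarrow> real"
    let ?K = "\<Prod>k\<in>{..<n}-{i}. jacobi_kernel a b (l k)"
    let ?S = "\<lambda>j. \<bar>l i - l j\<bar> powr (\<beta> - 1) * indicator {-2<..<2} (l i) * ?K"
    have K0: "?K \<ge> 0" by (intro prod_nonneg) (auto simp: jacobi_kernel_nonneg)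
    have Kall: "(\<Prod>k<n. jacobi_kernel a b (l k)) = jacobi_kernel a b (l i) * ?K"
      using i by (intro prod.remove) auto
    have Kall0: "(\<Prod>k<n. jacobi_kernel a b (l k)) \<ge> 0" by (intro prod_nonneg) (auto simp: jacobi_kernel_nonneg)
    have S0: "(\<Sum>j\<in>{..<n}-{i}. ?S j) \<ge> 0" using K0 by (intro sum_nonneg) auto
    show "\<bar>drift_term n a b \<beta> \<phi> \<phi>' i l\<bar> \<le> (D1 + D2) * ((\<Prod>k<n. jacobi_kernel a b (l k)) + (\<Sum>j\<in>{..<n}-{i}. ?S j))"
    proof (cases "\<forall>k<n. l k \<in> {-2<..<2}")
      case False
      then obtain k where k: "k < n" "l k \<notin> {-2<..<2}" by auto
      hence "drift_term n a b \<beta> \<phi> \<phi>' i l = 0" unfolding drift_term_def by (simp add: jacobi_ens_weight_eq_0)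
      thus ?thesis using D S0 Kall0 by simp
    next
      case True
      define w where "w = jacobi_ens_weight n a b \<beta> l"
      have w0: "w \<ge> 0" unfolding w_def by (rule jacobi_ens_weight_nonneg)
      have diff: "\<bar>l p - l q\<bar> powr \<beta> \<le> L" if "p < n" "q < n" for p q
      proof -
        have "l p \<in> {-2<..<2}" "l q \<in> {-2<..<2}" using True that by auto
        thus ?thesis unfolding L_def using \<beta> by (intro powr_mono2) auto
      qed
      have rest: "0 \<le> vandermonde_rest n \<beta> i l" "vandermonde_rest n \<beta> i l \<le> R"
        unfolding vandermonde_rest_def R_def
        by (intro prod_nonneg, simp) (intro prod_mono conjI prod_nonneg diff; auto)
      have rest2: "(\<Prod>j\<in>J. \<bar>l i - l j\<bar> powr \<beta>) \<le> P" if "J \<subseteq> {..<n} - {i}" for J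
      proof -
        have "(\<Prod>j\<in>J. \<bar>l i - l j\<bar> powr \<beta>) \<le> (\<Prod>j\<in>J. L)" using that i by (intro prod_mono) (auto intro: diff)
        also have "\<dots> \<le> P"
          unfolding P_def prod_constant using L1 that by (intro power_increasing card_mono) auto
        finally show ?thesis .
      qed
      have li: "l i \<in> {-2<..<2}" using True i by auto
      have sq: "0 \<le> 4 - (l i)\<^sup>2" "4 - (l i)\<^sup>2 \<le> 4"
        using li abs_le_square_iff[of "l i" 2] by auto
      have w1: "w \<le> R * P * (\<Prod>k<n. jacobi_kernel a b (l k))"
      proof -
        have "w = vandermonde_rest n \<beta> i l * (\<Prod>j\<in>{..<n}-{i}. \<bar>l i - l j\<bar> powr \<beta>) * (\<Prod>k<n. jacobi_kernel a b (l k))"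
          unfolding w_def jacobi_ens_weight_split[OF i] Kall by (simp add: ac_simps)
        also have "\<dots> \<le> R * P * (\<Prod>k<n. jacobi_kernel a b (l k))"
          by (intro mult_right_mono[OF _ Kall0] mult_mono rest rest2 order_refl R0 prod_nonneg) auto
        finally show ?thesis .
      qed
      have w2: "w * \<bar>(4 - (l i)\<^sup>2) / (l i - l j)\<bar> \<le> R * P * E * ?S j" if j: "j \<in> {..<n} - {i}" for j
      proof (cases "l i = l j")
        case True
        thus ?thesis using R0 P1 E0 K0 by simp
      next
        case False
        let ?Q = "\<Prod>j'\<in>{..<n}-{i}-{j}. \<bar>l i - l j'\<bar> powr \<beta>"
        have "(\<Prod>j\<in>{..<n}-{i}. \<bar>l i - l j\<bar> powr \<beta>) = \<bar>l i - l j\<bar> powr \<beta> * ?Q"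
          using j by (intro prod.remove) auto
        hence "w * \<bar>(4 - (l i)\<^sup>2) / (l i - l j)\<bar> = vandermonde_rest n \<beta> i l * ?Q *
           ((4 - (l i)\<^sup>2) * jacobi_kernel a b (l i)) * (\<bar>l i - l j\<bar> powr \<beta> / \<bar>l i - l j\<bar> * ?K)"
          unfolding w_def jacobi_ens_weight_split[OF i] using sq by (simp add: abs_divide abs_mult)
        also have "\<bar>l i - l j\<bar> powr \<beta> / \<bar>l i - l j\<bar> = \<bar>l i - l j\<bar> powr (\<beta> - 1)"
          using False by (simp add: powr_diff)
        also have "vandermonde_rest n \<beta> i l * ?Q * ((4 - (l i)\<^sup>2) * jacobi_kernel a b (l i)) * (\<bar>l i - l j\<bar> powr (\<beta> - 1) * ?K)
          \<le> R * P * E * (\<bar>l i - l j\<bar> powr (\<beta> - 1) * ?K)"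
        proof (intro mult_right_mono[OF mult_mono])
          show "vandermonde_rest n \<beta> i l * ?Q \<le> R * P"
            by (intro mult_mono rest rest2 R0 prod_nonneg) auto
          show "(4 - (l i)\<^sup>2) * jacobi_kernel a b (l i) \<le> E"
            using kernel_times_square_le[OF ab, of "l i"] li unfolding E_def by simp
          show "0 \<le> (4 - (l i)\<^sup>2) * jacobi_kernel a b (l i)"
            using sq(1) jacobi_kernel_nonneg by (rule mult_nonneg_nonneg)
        qed (use R0 P1 K0 in auto)
        finally show ?thesis using li by simp
      qed
      have r: "rank_of n l i < n" by (rule rank_of_less[OF i])
      have "\<bar>drift_term n a b \<beta> \<phi> \<phi>' i l\<bar> = w * \<bar>(4 - (l i)\<^sup>2) * \<phi>' (rank_of n l i) (l i) + \<phi> (rank_of n l i) (l i) * drift {..<n} \<beta> (a+1) (b+1) l i\<bar>"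
        unfolding drift_term_def w_def[symmetric] using w0 by (simp add: abs_mult)
      also have "\<dots> \<le> w * (4 * C + C * (\<beta> * (\<Sum>j\<in>{..<n}-{i}. \<bar>(4 - (l i)\<^sup>2) / (l i - l j)\<bar>) + (4 * (a + 1) + 4 * (b + 1))))"
      proof (intro mult_left_mono[OF _ w0] order_trans[OF abs_triangle_ineq] add_mono)
        show "\<bar>(4 - (l i)\<^sup>2) * \<phi>' (rank_of n l i) (l i)\<bar> \<le> 4 * C"
          unfolding abs_mult using sq C(2)[OF r, of "l i"] li by (intro mult_mono) auto
        have "\<bar>drift {..<n} \<beta> (a+1) (b+1) l i\<bar> \<le> \<beta> * \<bar>\<Sum>j\<in>{..<n}-{i}. (4 - (l i)\<^sup>2) / (l i - l j)\<bar> + \<bar>(a+1) * (2 + l i)\<bar> + \<bar>(b+1) * (2 - l i)\<bar>"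
        proof -
          have tri: "\<bar>x - y + z\<bar> \<le> \<bar>x\<bar> + \<bar>y\<bar> + \<bar>z\<bar>" for x y z :: real by linarith
          have "\<bar>\<beta> * s\<bar> = \<beta> * \<bar>s\<bar>" for s using \<beta> by (simp add: abs_mult)
          thus ?thesis unfolding drift_def using tri by metis
        qed
        also have "\<dots> \<le> \<beta> * (\<Sum>j\<in>{..<n}-{i}. \<bar>(4 - (l i)\<^sup>2) / (l i - l j)\<bar>) + (a+1) * 4 + (b+1) * 4"
          unfolding abs_mult using \<beta> ab li by (intro add_mono mult_left_mono sum_abs mult_mono) auto
        finally show "\<bar>\<phi> (rank_of n l i) (l i) * drift {..<n} \<beta> (a+1) (b+1) l i\<bar> \<le> 
           C * (\<beta> * (\<Sum>j\<in>{..<n}-{i}. \<bar>(4 - (l i)\<^sup>2) / (l i - l j)\<bar>) + (4 * (a + 1) + 4 * (b + 1)))"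
          unfolding abs_mult using C(1)[OF r, of "l i"] li by (intro mult_mono) auto
      qed
      also have "\<dots> = w * (4 * C + C * (4 * (a + 1) + 4 * (b + 1))) + C * \<beta> * (\<Sum>j\<in>{..<n}-{i}. w * \<bar>(4 - (l i)\<^sup>2) / (l i - l j)\<bar>)"
      proof -
        have "x * (c + C * (\<beta> * s + d)) = x * (c + C * d) + C * \<beta> * (x * s)" for x c s d :: real
          by (simp add: algebra_simps)
        thus ?thesis by (simp only: sum_distrib_left[symmetric])
      qed
      also have "\<dots> \<le> R * P * (\<Prod>k<n. jacobi_kernel a b (l k)) * (4 * C + C * (4 * (a + 1) + 4 * (b + 1)))
          + C * \<beta> * (\<Sum>j\<in>{..<n}-{i}. R * P * E * ?S j)"
      proof (rule add_mono)
        show "w * (4 * C + C * (4 * (a + 1) + 4 * (b + 1))) \<le> R * P * (\<Prod>k<n. jacobi_kernel a b (l k)) * (4 * C + C * (4 * (a + 1) + 4 * (b + 1)))"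
          using w1 by (rule mult_right_mono) (use C0 ab in auto)
        have "0 \<le> C * \<beta>" using C0 \<beta> by auto
        thus "C * \<beta> * (\<Sum>j\<in>{..<n}-{i}. w * \<bar>(4 - (l i)\<^sup>2) / (l i - l j)\<bar>) \<le> C * \<beta> * (\<Sum>j\<in>{..<n}-{i}. R * P * E * ?S j)"
          by (intro mult_left_mono sum_mono w2)
      qed
      also have "\<dots> = D1 * (\<Prod>k<n. jacobi_kernel a b (l k)) + D2 * (\<Sum>j\<in>{..<n}-{i}. ?S j)"
      proof -
        have "R * P * k * d + C * \<beta> * (R * P * E * s) = R * P * d * k + R * P * C * \<beta> * E * s" for k d s :: real
          by (simp add: algebra_simps)
        thus ?thesis unfolding D1_def D2_def by (simp only: sum_distrib_left[symmetric])
      qed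
      also have "\<dots> \<le> (D1 + D2) * ((\<Prod>k<n. jacobi_kernel a b (l k)) + (\<Sum>j\<in>{..<n}-{i}. ?S j))"
      proof -
        have "D1 * k + D2 * s \<le> (D1 + D2) * (k + s)" if "0 \<le> k" "0 \<le> s" for k s
          using D that by (simp add: algebra_simps)
        thus ?thesis using Kall0 S0 by blast
      qed
      finally show ?thesis .
    qed
  qed
qed

text \<open>Fubini with \<open>l i\<close> innermost: all factors without \<open>l i\<close> form a
  constant, and the inner integral is a multiple of the one in
  \<open>has_integral_drift_term\<close>. The joint integrability that Fubini demands comes from
  \<open>drift_term_bound\<close>.\<close>

lemma drift_term_integral:
  assumes ab: "a > -1" "b > -1" and \<beta>: "\<beta> > 0" and i: "i < n"
    and \<phi>: "\<And>k u. (\<phi> k has_real_derivative \<phi>' k u) (at u)" "\<And>k. continuous_on UNIV (\<phi>' k)"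
  shows "integrable (PiM {..<n} (\<lambda>_. lborel)) (drift_term n a b \<beta> \<phi> \<phi>' i)"
    and "integral\<^sup>L (PiM {..<n} (\<lambda>_. lborel)) (drift_term n a b \<beta> \<phi> \<phi>' i) = 0"
proof -
  interpret product_sigma_finite "\<lambda>_. lborel :: real measure" ..
  let ?M = "PiM {..<n} (\<lambda>_. lborel :: real measure)"
  let ?T = "drift_term n a b \<beta> \<phi> \<phi>' i"
  have cont: "continuous_on UNIV (\<phi> k)" for k
    using \<phi>(1) by (intro continuous_at_imp_continuous_on ballI DERIV_isCont) auto
  have ex: "\<exists>C. \<forall>k<n. \<forall>u\<in>{-2..2}. \<bar>f k u\<bar> \<le> C" if "\<And>k. continuous_on UNIV (f k)" for f :: "nat \<Rightarrow> real \<Rightarrow> real"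
  proof -
    have "\<exists>C. \<forall>u\<in>{-2..2}. \<bar>f k u\<bar> \<le> C" for k
      using compact_imp_bounded[OF compact_continuous_image[OF continuous_on_subset[OF that[of k]]], of "{-2..2}"]
      by (force simp: bounded_iff)
    then obtain C where C: "\<And>k u. u \<in> {-2..2} \<Longrightarrow> \<bar>f k u\<bar> \<le> C k" by metis
    have "\<bar>f k u\<bar> \<le> (\<Sum>k<n. \<bar>C k\<bar>)" if "k < n" "u \<in> {-2..2}" for k u
    proof -
      have "\<bar>f k u\<bar> \<le> \<bar>C k\<bar>" using C[OF that(2), of k] by auto
      also have "\<dots> \<le> (\<Sum>k<n. \<bar>C k\<bar>)" using that by (intro member_le_sum) auto
      finally show ?thesis .
    qed
    thus ?thesis by blast
  qed
  obtain C1 C2 where "\<forall>k<n. \<forall>u\<in>{-2..2}. \<bar>\<phi> k u\<bar> \<le> C1" "\<forall>k<n. \<forall>u\<in>{-2..2}. \<bar>\<phi>' k u\<bar> \<le> C2"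
    using ex[of \<phi>, OF cont] ex[of \<phi>', OF \<phi>(2)] by blast
  hence C: "k < n \<Longrightarrow> u \<in> {-2..2} \<Longrightarrow> \<bar>\<phi> k u\<bar> \<le> max C1 C2" "k < n \<Longrightarrow> u \<in> {-2..2} \<Longrightarrow> \<bar>\<phi>' k u\<bar> \<le> max C1 C2" for k u
    by (meson max.coboundedI1 max.coboundedI2)+
  obtain D where D: "\<And>l. \<bar>?T l\<bar> \<le> D * ((\<Prod>k<n. jacobi_kernel a b (l k)) +
     (\<Sum>j\<in>{..<n}-{i}. \<bar>l i - l j\<bar> powr (\<beta> - 1) * indicator {-2<..<2} (l i) * (\<Prod>k\<in>{..<n}-{i}. jacobi_kernel a b (l k))))"
    using drift_term_bound[where \<phi> = \<phi> and \<phi>' = \<phi>' and C = "max C1 C2", OF ab \<beta> i C] by blast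
  show int: "integrable ?M ?T"
  proof (rule Bochner_Integration.integrable_bound)
    show "integrable ?M (\<lambda>l. D * ((\<Prod>k<n. jacobi_kernel a b (l k)) +
     (\<Sum>j\<in>{..<n}-{i}. \<bar>l i - l j\<bar> powr (\<beta> - 1) * indicator {-2<..<2} (l i) * (\<Prod>k\<in>{..<n}-{i}. jacobi_kernel a b (l k)))))"
      using i by (intro integrable_mult_right Bochner_Integration.integrable_add Bochner_Integration.integrable_sum
          prod_kernel_integrable singular_pair_integrable ab \<beta>) auto
    show "?T \<in> borel_measurable ?M" by (rule drift_term_measurable[OF i cont \<phi>(2)])
    show "AE l in ?M. norm (?T l) \<le> norm (D * ((\<Prod>k<n. jacobi_kernel a b (l k)) +
     (\<Sum>j\<in>{..<n}-{i}. \<bar>l i - l j\<bar> powr (\<beta> - 1) * indicator {-2<..<2} (l i) * (\<Prod>k\<in>{..<n}-{i}. jacobi_kernel a b (l k)))))"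
      using D by (intro AE_I2) (auto intro: order_trans[OF _ abs_ge_self])
  qed
  have ins: "insert i ({..<n}-{i}) = {..<n}" using i by auto
  have "integral\<^sup>L ?M ?T = (\<integral>y. (\<integral>u. ?T (y(i := u)) \<partial>lborel) \<partial>PiM ({..<n}-{i}) (\<lambda>_. lborel))"
    by (rule product_integral_insert[of "{..<n}-{i}" i ?T, unfolded ins]) (use int in auto)
  also have "\<dots> = 0"
  proof -
    \<comment> \<open>Where the inner function is not integrable, its Bochner integral is \<open>0\<close> by convention.\<close>
    have "(\<integral>u. ?T (y(i := u)) \<partial>lborel) = 0" for y
    proof (cases "integrable lborel (\<lambda>u. ?T (y(i := u)))")
      case True
      let ?J = "{..<n} - {i}"
      define c where "c = vandermonde_rest n \<beta> i y * (\<Prod>k\<in>?J. jacobi_kernel a b (y k))"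
      define g where "g = (\<lambda>u. jacobi_kernel a b u * (\<Prod>j\<in>?J. \<bar>u - y j\<bar> powr \<beta>) * 
         ((4 - u\<^sup>2) * \<phi>' (card {j\<in>?J. y j < u}) u + \<phi> (card {j\<in>?J. y j < u}) u *
         (\<beta> * (\<Sum>j\<in>?J. (4 - u\<^sup>2) / (u - y j)) - (a+1) * (2 + u) + (b+1) * (2 - u))))"
      have g: "(g has_integral 0) {-2..2}"
        unfolding g_def by (intro has_integral_drift_term ab \<beta> \<phi>) auto
      have T: "?T (y(i := u)) = c * g u" for u
      proof -
        have rk: "rank_of n (y(i := u)) i = card {j\<in>?J. y j < u}"
          unfolding rank_of_def by (intro arg_cong[where f = card]) auto
        have rest: "vandermonde_rest n \<beta> i (y(i := u)) = vandermonde_rest n \<beta> i y"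
          unfolding vandermonde_rest_def by (intro prod.cong) auto
        have p1: "(\<Prod>k\<in>?J. jacobi_kernel a b ((y(i := u)) k)) = (\<Prod>k\<in>?J. jacobi_kernel a b (y k))"
          by (intro prod.cong) auto
        have p2: "(\<Prod>j\<in>?J. \<bar>(y(i := u)) i - (y(i := u)) j\<bar> powr \<beta>) = (\<Prod>j\<in>?J. \<bar>u - y j\<bar> powr \<beta>)"
          by (intro prod.cong) auto
        have p3: "(\<Sum>j\<in>?J. (4 - ((y(i := u)) i)\<^sup>2) / ((y(i := u)) i - (y(i := u)) j)) = (\<Sum>j\<in>?J. (4 - u\<^sup>2) / (u - y j))"
          by (intro sum.cong) auto
        show ?thesis
          unfolding drift_term_def jacobi_ens_weight_split[OF i] rk rest p1 p2 drift_def p3 c_def g_def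
          by (simp only: fun_upd_same mult.assoc)
      qed
      have "((\<lambda>u. c * g u) has_integral 0) {-2..2}"
        using has_integral_mult_right[OF g, of c] by (simp only: mult_zero_right)
      hence "((\<lambda>u. ?T (y(i := u))) has_integral 0) {-2..2}" unfolding T .
      moreover have "?T (y(i := u)) = 0" if "u \<notin> {-2..2}" for u
      proof -
        have "jacobi_ens_weight n a b \<beta> (y(i := u)) = 0" using that by (intro jacobi_ens_weight_eq_0[OF i]) auto
        thus ?thesis unfolding drift_term_def by (simp only: mult_zero_left)
      qed
      ultimately have "((\<lambda>u. ?T (y(i := u))) has_integral 0) UNIV"
        by (rule has_integral_on_superset[OF _ _ subset_UNIV])
      from has_integral_unique[OF has_integral_integral_lborel[OF True] this] show ?thesis .
    qed (rule not_integrable_integral_eq)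
    thus ?thesis by simp
  qed
  finally show "integral\<^sup>L ?M ?T = 0" .
qed

lemma jacobi_ens_weight_integrable:
  assumes ab: "a > -1" "b > -1" and \<beta>: "\<beta> > 0"
  shows "integrable (PiM {..<n} (\<lambda>_. lborel)) (jacobi_ens_weight n a b \<beta>)"
proof (rule Bochner_Integration.integrable_bound)
  let ?L = "(\<Prod>i<n. \<Prod>j\<in>{i<..<n}. (4::real) powr \<beta>)"
  show "integrable (PiM {..<n} (\<lambda>_. lborel)) (\<lambda>l. ?L * (\<Prod>k<n. jacobi_kernel a b (l k)))"
    by (intro integrable_mult_right prod_kernel_integrable ab) auto
  show "AE l in PiM {..<n} (\<lambda>_. lborel). norm (jacobi_ens_weight n a b \<beta> l) \<le> norm (?L * (\<Prod>k<n. jacobi_kernel a b (l k)))"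
  proof (intro AE_I2)
    fix l :: "nat \<Rightarrow> real"
    have K: "0 \<le> (\<Prod>k<n. jacobi_kernel a b (l k))" by (intro prod_nonneg) (auto simp: jacobi_kernel_nonneg)
    have "jacobi_ens_weight n a b \<beta> l \<le> ?L * (\<Prod>k<n. jacobi_kernel a b (l k))"
    proof (cases "\<forall>k<n. l k \<in> {-2<..<2}")
      case False
      then obtain k where k: "k < n" "l k \<notin> {-2<..<2}" by auto
      thus ?thesis using K by (simp add: jacobi_ens_weight_eq_0 prod_nonneg)
    next
      case True
      have "\<bar>l p - l q\<bar> powr \<beta> \<le> 4 powr \<beta>" if "p < n" "q < n" for p q
      proof -
        have "l p \<in> {-2<..<2}" "l q \<in> {-2<..<2}" using True that by auto
        thus ?thesis using \<beta> by (intro powr_mono2) auto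
      qed
      thus ?thesis
        unfolding jacobi_ens_weight_def jacobi_kernel_def[symmetric]
        by (intro mult_right_mono[OF _ K] prod_mono conjI prod_nonneg) auto
    qed
    thus "norm (jacobi_ens_weight n a b \<beta> l) \<le> norm (?L * (\<Prod>k<n. jacobi_kernel a b (l k)))"
      using jacobi_ens_weight_nonneg[of n a b \<beta> l] by (auto intro: order_trans[OF _ abs_ge_self])
  qed
qed measurable

subsection \<open>Moments of the deviations\<close>

text \<open>At 0 the difference quotient is \<open>max h 0 ^ m / (m+1)\<close>, which tends to 0
  only for positive \<open>m\<close>; with \<open>m = 0\<close> the kink would remain. This is why
  the moments below take \<open>k > 0\<close>.\<close>

lemma has_real_derivative_max_power:
  fixes t :: real
  assumes "m > 0"
  shows "((\<lambda>t. max t 0 ^ (m+1) / real (m+1)) has_real_derivative max t 0 ^ m) (at t)"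
proof -
  consider "t > 0" | "t < 0" | "t = 0" by linarith
  thus ?thesis
  proof cases
    case 1
    have d: "((\<lambda>t. t ^ Suc m / real (Suc m)) has_real_derivative t ^ m) (at t)"
      using DERIV_cdivide[OF DERIV_pow[of "Suc m" t], of "real (Suc m)"] by (simp del: of_nat_Suc)
    have "\<forall>\<^sub>F x in nhds t. x > 0" using 1 by (intro order_tendstoD) (auto simp: filterlim_ident)
    hence ev: "\<forall>\<^sub>F x in nhds t. x ^ Suc m / real (Suc m) = max x 0 ^ (m+1) / real (m+1)"
      by eventually_elim auto
    show ?thesis using DERIV_cong_ev[OF refl ev refl, THEN iffD1, OF d] 1 by (simp add: max_def)
  next
    case 2
    have "\<forall>\<^sub>F x in nhds t. x < 0" using 2 by (intro order_tendstoD) (auto simp: filterlim_ident)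
    hence ev: "\<forall>\<^sub>F x in nhds t. 0 = max x 0 ^ (m+1) / real (m+1)"
      by eventually_elim (auto simp: max_def)
    have "max t 0 ^ m = 0" using 2 assms by simp
    thus ?thesis using DERIV_cong_ev[OF refl ev refl, THEN iffD1, OF DERIV_const] by (simp only:)
  next
    case 3
    have "((\<lambda>h::real. max h 0 ^ m / real (m+1)) \<longlongrightarrow> max 0 0 ^ m / real (m+1)) (at 0)"
      by (intro tendsto_intros) auto
    hence "((\<lambda>h::real. max h 0 ^ m / real (m+1)) \<longlongrightarrow> 0) (at 0)" using assms by (simp add: zero_power)
    moreover have "max h 0 ^ m / real (m+1) = (max (0+h) 0 ^ (m+1) / real (m+1) - max 0 0 ^ (m+1) / real (m+1)) / h" if "h \<noteq> 0" for h :: real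
      using that assms by (auto simp: max_def)
    hence "\<forall>\<^sub>F h::real in at 0. max h 0 ^ m / real (m+1) = (max (0+h) 0 ^ (m+1) / real (m+1) - max 0 0 ^ (m+1) / real (m+1)) / h"
      unfolding eventually_at_filter by (intro always_eventually) auto
    ultimately have "((\<lambda>h::real. (max (0+h) 0 ^ (m+1) / real (m+1) - max 0 0 ^ (m+1) / real (m+1)) / h) \<longlongrightarrow> 0) (at 0)"
      by (rule Lim_transform_eventually)
    thus ?thesis using assms unfolding DERIV_def 3 by (simp add: zero_power)
  qed
qed

text \<open>The first damping term of \<open>drift_one_sided\<close> turns \<open>Y ^ m\<close> into
  \<open>z ^ k * (1 - z / q)\<close> with \<open>z = Y\<^sup>2\<close>, which is at most
  \<open>q ^ k\<close> if \<open>z \<le> q\<close> and negative otherwise. The even exponent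
  \<open>m\<close> makes this a comparison of \<open>z\<close> with \<open>q\<close>. The second
  damping term is left over and carries the moment.\<close>

lemma drift_sum_le:
  fixes l x :: "'a \<Rightarrow> real" and A B \<beta> :: real and k :: nat
  defines "Y \<equiv> \<lambda>i. max (l i - x i) 0" and "m \<equiv> 2 * k"
  assumes I: "finite I" and A: "A > 0" and B: "B > 0" and \<beta>: "\<beta> > 0"
    and l: "\<And>i. i \<in> I \<Longrightarrow> \<bar>l i\<bar> < 2"
    and x: "equilibrium I \<beta> A B x"
    and ord: "\<And>i j. i \<in> I \<Longrightarrow> j \<in> I \<Longrightarrow> i \<noteq> j \<Longrightarrow> (l i - l j) * (x i - x j) > 0"
  shows "(\<Sum>i\<in>I. (4 - (l i)\<^sup>2) * Y i ^ m + Y i ^ (m+1) / real (m+1) * drift I \<beta> A B l i) \<le>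
     4 * real (card I) * (16 * real (m+3) / (A + B)) ^ k
       - (A + B) / (real (m+1) * real (m+2)) * (\<Sum>i\<in>I. Y i ^ (m+2))"
proof -
  define q where "q = 16 * real (m+3) / (A + B)"
  have q: "q > 0" unfolding q_def using A B by simp
  have "(\<Sum>i\<in>I. (4 - (l i)\<^sup>2) * Y i ^ m + Y i ^ (m+1) / real (m+1) * drift I \<beta> A B l i)
     = (\<Sum>i\<in>I. (4 - (l i)\<^sup>2) * Y i ^ m) + (\<Sum>i\<in>I. Y i ^ (m+1) / real (m+1) * drift I \<beta> A B l i)"
    by (rule sum.distrib)
  also have "\<dots> \<le> (\<Sum>i\<in>I. (4 - (l i)\<^sup>2) * Y i ^ m) + - (\<Sum>i\<in>I. (A + B) * (4 - (l i)\<^sup>2) * Y i ^ (m+2) / (16 * real (m+3)) 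
          + (A + B) * Y i ^ (m+2) / (real (m+1) * real (m+2)))"
    unfolding Y_def by (intro add_left_mono drift_one_sided I A B \<beta> l x ord)
  also have "\<dots> = (\<Sum>i\<in>I. (4 - (l i)\<^sup>2) * (Y i ^ m - Y i ^ (m+2) / q) - (A + B) / (real (m+1) * real (m+2)) * Y i ^ (m+2))"
    unfolding sum_negf[symmetric] sum.distrib[symmetric] q_def using A B
    by (intro sum.cong refl) (simp add: field_simps)
  also have "\<dots> \<le> (\<Sum>i\<in>I. 4 * q ^ k - (A + B) / (real (m+1) * real (m+2)) * Y i ^ (m+2))"
  proof (intro sum_mono diff_right_mono)
    fix i assume i: "i \<in> I"
    have sq: "0 \<le> 4 - (l i)\<^sup>2" "4 - (l i)\<^sup>2 \<le> 4"
      using l[OF i] abs_le_square_iff[of "l i" 2] by auto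
    define z where "z = (Y i)\<^sup>2"
    have z: "z \<ge> 0" "Y i ^ m = z ^ k" "Y i ^ (m+2) = z ^ k * z"
      unfolding z_def m_def by (simp_all add: power_mult power_add power2_eq_square)
    have "z ^ k - z ^ k * z / q = z ^ k * (1 - z / q)" by (simp add: algebra_simps)
    also have "\<dots> \<le> q ^ k"
    proof (cases "z \<le> q")
      case True
      have "z ^ k * (1 - z / q) \<le> q ^ k * 1"
        using True q z by (intro mult_mono power_mono) auto
      thus ?thesis by simp
    next
      case False
      hence "1 - z / q \<le> 0" using q by simp
      hence "z ^ k * (1 - z / q) \<le> 0" using z by (intro mult_nonneg_nonpos) auto
      thus ?thesis using q by (meson order_trans zero_le_power less_imp_le)
    qed
    finally have 1: "z ^ k - z ^ k * z / q \<le> q ^ k" .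
    have "(4 - (l i)\<^sup>2) * (z ^ k - z ^ k * z / q) \<le> (4 - (l i)\<^sup>2) * q ^ k"
      using 1 sq by (intro mult_left_mono) auto
    also have "\<dots> \<le> 4 * q ^ k" using sq q by (intro mult_right_mono) auto
    finally show "(4 - (l i)\<^sup>2) * (Y i ^ m - Y i ^ (m+2) / q) \<le> 4 * q ^ k" unfolding z .
  qed
  also have "\<dots> = 4 * real (card I) * q ^ k - (A + B) / (real (m+1) * real (m+2)) * (\<Sum>i\<in>I. Y i ^ (m+2))"
    by (simp add: sum_subtractf sum_distrib_left)
  finally show ?thesis unfolding q_def .
qed

section \<open>Reflection, and matching particles with equilibrium points by rank\<close>

lemma equilibrium_reflect:
  assumes "equilibrium I \<beta> A B x"
  shows "equilibrium I \<beta> B A (\<lambda>i. - x i)"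
  unfolding equilibrium_def
proof (intro ballI conjI)
  fix i assume i: "i \<in> I"
  show "\<bar>- x i\<bar> < 2" using assms i unfolding equilibrium_def by auto
  have "(\<Sum>j\<in>I-{i}. 1 / (- x i - - x j)) = (\<Sum>j\<in>I-{i}. - (1 / (x i - x j)))"
    by (intro sum.cong refl) (metis minus_diff_eq minus_divide_right diff_minus_eq_add add.commute uminus_add_conv_diff)
  also have "\<dots> = - (\<Sum>j\<in>I-{i}. 1 / (x i - x j))" by (rule sum_negf)
  finally have "\<beta> * (\<Sum>j\<in>I-{i}. 1 / (- x i - - x j)) = - (\<beta> * (\<Sum>j\<in>I-{i}. 1 / (x i - x j)))" by simp
  thus "\<beta> * (\<Sum>j\<in>I-{i}. 1 / (- x i - - x j)) = B / (2 - - x i) - A / (2 + - x i)"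
    using assms i unfolding equilibrium_def by auto
qed

text \<open>Reflection exchanges the endpoints and the parameters \<open>A\<close> and
  \<open>B\<close>, so bounds for particles to the right of their targets also serve those to the
  left.\<close>

lemma drift_reflect: "drift I \<beta> B A (\<lambda>i. - l i) i = - drift I \<beta> A B l i"
proof -
  have "(\<Sum>j\<in>I-{i}. (4 - (- l i)\<^sup>2) / (- l i - - l j)) = (\<Sum>j\<in>I-{i}. - ((4 - (l i)\<^sup>2) / (l i - l j)))"
    by (intro sum.cong refl) (simp, metis minus_diff_eq minus_divide_right)
  thus ?thesis unfolding drift_def by (simp add: sum_negf)
qed

lemma rank_of_strict_mono:
  assumes "l i < l j" "i < n"
  shows "rank_of n l i < rank_of n l j"
  unfolding rank_of_def using assms by (intro psubset_card_mono) auto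

lemma rank_of_bij:
  assumes "inj_on l {..<n}"
  shows "bij_betw (rank_of n l) {..<n} {..<n}"
proof -
  have "inj_on (rank_of n l) {..<n}"
  proof (rule inj_onI)
    fix i j assume ij: "i \<in> {..<n}" "j \<in> {..<n}" "rank_of n l i = rank_of n l j"
    hence "\<not> l i < l j" "\<not> l j < l i" using rank_of_strict_mono[of l i j n] rank_of_strict_mono[of l j i n] by auto
    thus "i = j" using assms ij by (auto simp: inj_on_def)
  qed
  moreover have "rank_of n l ` {..<n} \<subseteq> {..<n}" using rank_of_less by auto
  ultimately show ?thesis by (simp add: bij_betw_def endo_inj_surj)
qed

text \<open>Used with \<open>r\<close> the rank map: each labelled particle is compared with the
  equilibrium point of its own rank, and a permutation of the labels only permutes Stieltjes'
  equations.\<close>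

lemma equilibrium_reindex:
  assumes "equilibrium I \<beta> A B x" "bij_betw r I I"
  shows "equilibrium I \<beta> A B (\<lambda>i. x (r i))"
  unfolding equilibrium_def
proof (intro ballI conjI)
  fix i assume i: "i \<in> I"
  hence ri: "r i \<in> I" using assms(2) by (auto simp: bij_betw_def)
  show "\<bar>x (r i)\<bar> < 2" using assms ri unfolding equilibrium_def by auto
  have "bij_betw r (I - {i}) (I - {r i})"
    using assms(2) i by (auto simp: bij_betw_def inj_on_def)
  hence "(\<Sum>j\<in>I-{i}. 1 / (x (r i) - x (r j))) = (\<Sum>j\<in>I-{r i}. 1 / (x (r i) - x j))"
    by (rule sum.reindex_bij_betw)
  thus "\<beta> * (\<Sum>j\<in>I-{i}. 1 / (x (r i) - x (r j))) = A / (2 - x (r i)) - B / (2 + x (r i))"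
    using assms(1) ri unfolding equilibrium_def by auto
qed

text \<open>Exactly the \<open>j\<close> entries before position \<open>j\<close> of the sorted list
  are smaller than the entry there. Deviations of order statistics thus become deviations of
  labelled particles, and the integrals need not be restricted to ordered configurations.\<close>

lemma order_stat_rank:
  assumes inj: "inj_on l {..<n}" and j: "j < n"
  obtains i where "i < n" "rank_of n l i = j" "order_stat n l j = l i"
proof -
  define ys where "ys = sort (map l [0..<n])"
  have set: "set ys = l ` {..<n}" unfolding ys_def by (auto simp: atLeast0LessThan)
  have len: "length ys = n" unfolding ys_def by simp
  have dist: "distinct ys" unfolding ys_def using inj by (simp add: distinct_map atLeast0LessThan)
  have sorted: "sorted_wrt (<) ys" using dist unfolding ys_def by (simp add: strict_sorted_iff)
  obtain i where i: "i < n" "ys ! j = l i" using nth_mem[of j ys] j len set by auto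
  have "l ` {k\<in>{..<n}. l k < l i} = (\<lambda>k. ys ! k) ` {..<j}"
  proof (intro equalityI subsetI)
    fix v assume "v \<in> l ` {k\<in>{..<n}. l k < l i}"
    hence v: "v \<in> set ys" "v < ys ! j" using i set by auto
    then obtain k where k: "k < n" "v = ys ! k" using len by (metis in_set_conv_nth)
    have "k < j"
    proof (rule ccontr)
      assume "\<not> k < j"
      hence "ys ! j \<le> ys ! k" using sorted_wrt_nth_less[OF sorted, of j k] k len by (cases "k = j") auto
      thus False using v k by simp
    qed
    thus "v \<in> (\<lambda>k. ys ! k) ` {..<j}" using k by auto
  next
    fix v assume "v \<in> (\<lambda>k. ys ! k) ` {..<j}"
    then obtain k where k: "k < j" "v = ys ! k" by auto
    hence "v \<in> set ys" "v < ys ! j" using j len sorted_wrt_nth_less[OF sorted, of k j] by auto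
    thus "v \<in> l ` {k\<in>{..<n}. l k < l i}" using set i by auto
  qed
  hence "card (l ` {k\<in>{..<n}. l k < l i}) = card ((\<lambda>k. ys ! k) ` {..<j})" by simp
  also have "\<dots> = j" using dist j len by (subst card_image) (auto simp: inj_on_def nth_eq_iff_index_eq)
  also have "card (l ` {k\<in>{..<n}. l k < l i}) = rank_of n l i"
    unfolding rank_of_def by (rule card_image) (use inj in \<open>auto simp: inj_on_def\<close>)
  finally show ?thesis using that[of i] i unfolding order_stat_def ys_def by simp
qed

text \<open>Lets pointwise estimates assume distinct particles inside the interval, where the ranks
  form a permutation; elsewhere the integrands vanish with the density.\<close>

lemma jacobi_ens_weight_pos_imp:
  assumes "jacobi_ens_weight n a b \<beta> l \<noteq> 0"
  shows "inj_on l {..<n}" "\<And>i. i < n \<Longrightarrow> \<bar>l i\<bar> < 2"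
proof -
  show "\<bar>l i\<bar> < 2" if "i < n" for i
  proof -
    have "l i \<in> {-2<..<2}" using assms jacobi_ens_weight_eq_0[OF that, of l a b \<beta>] by blast
    thus ?thesis by auto
  qed
  have "(\<Prod>p<n. \<Prod>q\<in>{p<..<n}. \<bar>l p - l q\<bar> powr \<beta>) \<noteq> 0"
    using assms unfolding jacobi_ens_weight_def by auto
  hence ne: "l p \<noteq> l q" if "p < q" "q < n" for p q
    using that by (fastforce simp: prod_zero_iff)
  show "inj_on l {..<n}"
  proof (rule inj_onI)
    fix p q assume "p \<in> {..<n}" "q \<in> {..<n}" "l p = l q"
    thus "p = q" using ne[of p q] ne[of q p] by (cases p q rule: linorder_cases) auto
  qed
qed

lemma rank_of_order:
  assumes inj: "inj_on l {..<n}" and x: "\<And>i j. i < j \<Longrightarrow> j < n \<Longrightarrow> x i < x j" and ij: "i < n" "j < n" "i \<noteq> j"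
  shows "(l i - l j) * (x (rank_of n l i) - x (rank_of n l j)) > (0::real)"
proof -
  have "l i \<noteq> l j" using inj ij by (auto simp: inj_on_def)
  then consider "l i < l j" | "l j < l i" by linarith
  thus ?thesis
  proof cases
    case 1
    thus ?thesis using x[OF rank_of_strict_mono[OF 1 ij(1)] rank_of_less[OF ij(2)]] by (simp add: mult_neg_neg)
  next
    case 2
    thus ?thesis using x[OF rank_of_strict_mono[OF 2 ij(2)] rank_of_less[OF ij(1)]] by simp
  qed
qed

text \<open>The sign \<open>s\<close> selects deviations to the right or to the left. The outer
  \<open>s\<close> in \<open>\<phi>\<close> meets the inner one on differentiation, so
  \<open>s * s = 1\<close> leaves \<open>\<phi>'\<close> nonnegative in both cases; for
  \<open>s = -1\<close> the estimate is the reflected one.\<close>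

lemma drift_term_sum_le:
  fixes n k :: nat and x :: "nat \<Rightarrow> real" and s a b \<beta> :: real
  defines "m \<equiv> 2 * k"
  defines "\<phi> \<equiv> \<lambda>j u. s * (max (s * (u - x j)) 0 ^ (m+1) / real (m+1))"
    and "\<phi>' \<equiv> \<lambda>j u. max (s * (u - x j)) 0 ^ m"
  assumes s: "s = 1 \<or> s = -1" and ab: "a > -1" "b > -1" and \<beta>: "\<beta> > 0"
    and eq: "equilibrium {..<n} \<beta> (a+1) (b+1) x" and x: "\<And>i j. i < j \<Longrightarrow> j < n \<Longrightarrow> x i < x j"
  shows "(\<Sum>i<n. drift_term n a b \<beta> \<phi> \<phi>' i l) \<le> jacobi_ens_weight n a b \<beta> l *
      (4 * real n * (16 * real (m+3) / (a + b + 2)) ^ k - (a + b + 2) / (real (m+1) * real (m+2)) *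
         (\<Sum>i<n. max (s * (l i - x (rank_of n l i))) 0 ^ (m+2)))"
proof (cases "jacobi_ens_weight n a b \<beta> l = 0")
  case True
  thus ?thesis unfolding drift_term_def by simp
next
  case False
  note pos = jacobi_ens_weight_pos_imp[OF False]
  define x' where "x' = (\<lambda>i. x (rank_of n l i))"
  have eq': "equilibrium {..<n} \<beta> (a+1) (b+1) x'"
    unfolding x'_def by (rule equilibrium_reindex[OF eq rank_of_bij[OF pos(1)]])
  have ord: "(l i - l j) * (x' i - x' j) > 0" if "i \<in> {..<n}" "j \<in> {..<n}" "i \<noteq> j" for i j
    unfolding x'_def using that by (intro rank_of_order pos(1) x) auto
  define Y where "Y = (\<lambda>i. max (s * (l i - x' i)) 0)"
  define R where "R = 4 * real n * (16 * real (m+3) / (a + b + 2)) ^ k - (a + b + 2) / (real (m+1) * real (m+2)) *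
         (\<Sum>i<n. Y i ^ (m+2))"
  have "(\<Sum>i<n. (4 - (l i)\<^sup>2) * Y i ^ m + Y i ^ (m+1) / real (m+1) * (s * drift {..<n} \<beta> (a+1) (b+1) l i)) \<le> R"
    using s
  proof
    assume s: "s = 1"
    show ?thesis
      using drift_sum_le[of "{..<n}" "a+1" "b+1" \<beta> l x' k] ab \<beta> pos(2) eq' ord
      unfolding s R_def Y_def m_def by (simp add: add.commute add.left_commute)
  next
    assume s: "s = -1"
    have d: "drift {..<n} \<beta> (b+1) (a+1) (\<lambda>i. - l i) i = - drift {..<n} \<beta> (a+1) (b+1) l i" for i
      by (rule drift_reflect)
    have ord': "(- l i - - l j) * (- x' i - - x' j) > 0" if "i \<in> {..<n}" "j \<in> {..<n}" "i \<noteq> j" for i j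
      using ord[OF that] by (simp add: algebra_simps)
    show ?thesis
      using drift_sum_le[of "{..<n}" "b+1" "a+1" \<beta> "\<lambda>i. - l i" "\<lambda>i. - x' i" k] ab \<beta> pos(2) equilibrium_reflect[OF eq'] ord'
      unfolding s R_def Y_def m_def d by (simp add: add.commute add.left_commute)
  qed
  hence "jacobi_ens_weight n a b \<beta> l * (\<Sum>i<n. (4 - (l i)\<^sup>2) * Y i ^ m + Y i ^ (m+1) / real (m+1) * (s * drift {..<n} \<beta> (a+1) (b+1) l i))
    \<le> jacobi_ens_weight n a b \<beta> l * R"
    by (intro mult_left_mono jacobi_ens_weight_nonneg)
  moreover have "(\<Sum>i<n. drift_term n a b \<beta> \<phi> \<phi>' i l) = jacobi_ens_weight n a b \<beta> l * 
     (\<Sum>i<n. (4 - (l i)\<^sup>2) * Y i ^ m + Y i ^ (m+1) / real (m+1) * (s * drift {..<n} \<beta> (a+1) (b+1) l i))"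
    unfolding sum_distrib_left drift_term_def \<phi>_def \<phi>'_def Y_def x'_def
    by (intro sum.cong refl) (simp only: ac_simps)
  ultimately show ?thesis unfolding R_def Y_def x'_def by (simp only:)
qed

lemma deviation_measurable:
  assumes "i < n"
  shows "(\<lambda>l. max (s * (l i - x (rank_of n l i))) 0 ^ p) \<in> borel_measurable (PiM {..<n} (\<lambda>_. lborel :: real measure))"
  by (rule rank_dependent_measurable[OF assms, of "\<lambda>k u. max (s * (u - x k)) 0 ^ p"])
     (intro continuous_intros)

lemma deviation_moment_integrable:
  assumes ab: "a > -1" "b > -1" and \<beta>: "\<beta> > 0" and s: "s = 1 \<or> s = -1" and x: "\<And>i. i < n \<Longrightarrow> \<bar>x i\<bar> < 2"
  shows "integrable (PiM {..<n} (\<lambda>_. lborel)) (\<lambda>l. jacobi_ens_weight n a b \<beta> l * (\<Sum>i<n. max (s * (l i - x (rank_of n l i))) 0 ^ p))"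
proof (rule Bochner_Integration.integrable_bound)
  show "integrable (PiM {..<n} (\<lambda>_. lborel)) (\<lambda>l. jacobi_ens_weight n a b \<beta> l * (real n * 4 ^ p))"
    by (intro integrable_mult_left jacobi_ens_weight_integrable ab \<beta>)
  show "(\<lambda>l. jacobi_ens_weight n a b \<beta> l * (\<Sum>i<n. max (s * (l i - x (rank_of n l i))) 0 ^ p)) \<in> borel_measurable (PiM {..<n} (\<lambda>_. lborel))"
    by (intro borel_measurable_times jacobi_ens_weight_measurable borel_measurable_sum deviation_measurable) auto
  show "AE l in PiM {..<n} (\<lambda>_. lborel). norm (jacobi_ens_weight n a b \<beta> l * (\<Sum>i<n. max (s * (l i - x (rank_of n l i))) 0 ^ p))
     \<le> norm (jacobi_ens_weight n a b \<beta> l * (real n * 4 ^ p))"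
  proof (intro AE_I2)
    fix l :: "nat \<Rightarrow> real"
    show "norm (jacobi_ens_weight n a b \<beta> l * (\<Sum>i<n. max (s * (l i - x (rank_of n l i))) 0 ^ p))
     \<le> norm (jacobi_ens_weight n a b \<beta> l * (real n * 4 ^ p))"
    proof (cases "jacobi_ens_weight n a b \<beta> l = 0")
      case False
      have "max (s * (l i - x (rank_of n l i))) 0 ^ p \<le> 4 ^ p" if "i < n" for i
        using s jacobi_ens_weight_pos_imp(2)[OF False that] x[OF rank_of_less[OF that, of l]]
        by (intro power_mono) auto
      hence "(\<Sum>i<n. max (s * (l i - x (rank_of n l i))) 0 ^ p) \<le> (\<Sum>i<n. 4 ^ p)" by (intro sum_mono) auto
      moreover have "0 \<le> (\<Sum>i<n. max (s * (l i - x (rank_of n l i))) 0 ^ p)" by (intro sum_nonneg) auto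
      ultimately have "\<bar>\<Sum>i<n. max (s * (l i - x (rank_of n l i))) 0 ^ p\<bar> \<le> \<bar>real n * 4 ^ p\<bar>" by simp
      from mult_left_mono[OF this abs_ge_zero, of "jacobi_ens_weight n a b \<beta> l"]
      show ?thesis by (simp only: real_norm_def abs_mult[of "jacobi_ens_weight n a b \<beta> l"])
    qed simp
  qed
qed

text \<open>The drift terms integrate to 0 and lie pointwise below
  \<open>f l * (P - c * S l)\<close>, whose integral is therefore nonnegative; solving for the
  integral of \<open>f l * S l\<close> gives the moment.\<close>

lemma deviation_moment_le:
  fixes n k :: nat and x :: "nat \<Rightarrow> real" and s a b \<beta> :: real
  defines "m \<equiv> 2 * k" and "M \<equiv> PiM {..<n} (\<lambda>_. lborel :: real measure)"
  assumes k: "k > 0" and s: "s = 1 \<or> s = -1" and ab: "a > -1" "b > -1" and \<beta>: "\<beta> > 0"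
    and eq: "equilibrium {..<n} \<beta> (a+1) (b+1) x" and x: "\<And>i j. i < j \<Longrightarrow> j < n \<Longrightarrow> x i < x j"
  shows "integral\<^sup>L M (\<lambda>l. jacobi_ens_weight n a b \<beta> l * (\<Sum>i<n. max (s * (l i - x (rank_of n l i))) 0 ^ (m+2)))
    \<le> 4 * real n * (16 * real (m+3) / (a + b + 2)) ^ k * (real (m+1) * real (m+2) / (a + b + 2)) 
       * integral\<^sup>L M (jacobi_ens_weight n a b \<beta>)"
proof -
  define \<phi> where "\<phi> = (\<lambda>j u. s * (max (s * (u - x j)) 0 ^ (m+1) / real (m+1)))"
  define \<phi>' where "\<phi>' = (\<lambda>j u. max (s * (u - x j)) 0 ^ m)"
  define f where "f = jacobi_ens_weight n a b \<beta>"
  define S where "S = (\<lambda>l. \<Sum>i<n. max (s * (l i - x (rank_of n l i))) 0 ^ (m+2))"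
  define P where "P = 4 * real n * (16 * real (m+3) / (a + b + 2)) ^ k"
  define c where "c = (a + b + 2) / (real (m+1) * real (m+2))"
  have c: "c > 0" unfolding c_def using ab by simp
  have m0: "m > 0" using k unfolding m_def by simp
  have d\<phi>: "(\<phi> j has_real_derivative \<phi>' j u) (at u)" for j u
  proof -
    have lin: "((\<lambda>u. s * (u - x j)) has_real_derivative s) (at u)"
      by (auto intro!: derivative_eq_intros)
    have "((\<lambda>u. s * (max (s * (u - x j)) 0 ^ (m+1) / real (m+1))) has_real_derivative
       s * (max (s * (u - x j)) 0 ^ m * s)) (at u)"
      by (intro DERIV_cmult DERIV_chain2[OF has_real_derivative_max_power[OF m0] lin])
    also have "s * (max (s * (u - x j)) 0 ^ m * s) = \<phi>' j u" unfolding \<phi>'_def using s by auto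
    finally show ?thesis unfolding \<phi>_def .
  qed
  have c\<phi>': "continuous_on UNIV (\<phi>' j)" for j unfolding \<phi>'_def by (intro continuous_intros)
  have T: "integrable M (drift_term n a b \<beta> \<phi> \<phi>' i)" "integral\<^sup>L M (drift_term n a b \<beta> \<phi> \<phi>' i) = 0"
    if "i < n" for i
    unfolding M_def by (rule drift_term_integral[OF ab \<beta> that d\<phi> c\<phi>'])+
  have int_f: "integrable M f" unfolding f_def M_def by (rule jacobi_ens_weight_integrable[OF ab \<beta>])
  have "\<bar>x i\<bar> < 2" if "i < n" for i using eq that unfolding equilibrium_def by auto
  hence int_S: "integrable M (\<lambda>l. f l * S l)"
    unfolding f_def S_def M_def by (intro deviation_moment_integrable ab \<beta> s)
  have "0 = integral\<^sup>L M (\<lambda>l. \<Sum>i<n. drift_term n a b \<beta> \<phi> \<phi>' i l)"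
    using T by (subst Bochner_Integration.integral_sum) auto
  also have "\<dots> \<le> integral\<^sup>L M (\<lambda>l. P * f l - c * (f l * S l))"
  proof (rule integral_mono)
    show "integrable M (\<lambda>l. \<Sum>i<n. drift_term n a b \<beta> \<phi> \<phi>' i l)"
      using T by (intro Bochner_Integration.integrable_sum) auto
    show "integrable M (\<lambda>l. P * f l - c * (f l * S l))" using int_f int_S by auto
    fix l
    have "(\<Sum>i<n. drift_term n a b \<beta> \<phi> \<phi>' i l) \<le> f l * (P - c * S l)"
      unfolding \<phi>_def \<phi>'_def f_def P_def c_def S_def m_def
      by (intro drift_term_sum_le s ab \<beta> eq x)
    thus "(\<Sum>i<n. drift_term n a b \<beta> \<phi> \<phi>' i l) \<le> P * f l - c * (f l * S l)" by (simp add: algebra_simps)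
  qed
  also have "\<dots> = P * integral\<^sup>L M f - c * integral\<^sup>L M (\<lambda>l. f l * S l)"
    using int_f int_S by simp
  finally have "c * integral\<^sup>L M (\<lambda>l. f l * S l) \<le> P * integral\<^sup>L M f" by simp
  hence "integral\<^sup>L M (\<lambda>l. f l * S l) \<le> P * integral\<^sup>L M f / c" using c by (simp add: field_simps)
  also have "\<dots> = P * (real (m+1) * real (m+2) / (a + b + 2)) * integral\<^sup>L M f" unfolding c_def by simp
  finally show ?thesis unfolding f_def S_def P_def .
qed

section \<open>From moments to the tail probability\<close>

lemma emeasure_jacobi_ensemble_le:
  assumes E: "E \<in> sets (jacobi_ensemble n a b \<beta>)" and p: "p \<ge> 0"
    and le: "(\<integral>\<^sup>+l. ennreal (jacobi_ens_weight n a b \<beta> l) * indicator E l \<partial>PiM {..<n} (\<lambda>_. lborel)) \<le>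
      ennreal p * (\<integral>\<^sup>+l. ennreal (jacobi_ens_weight n a b \<beta> l) \<partial>PiM {..<n} (\<lambda>_. lborel))"
  shows "measure (jacobi_ensemble n a b \<beta>) E \<le> p"
proof -
  let ?M = "PiM {..<n} (\<lambda>_. lborel :: real measure)"
  let ?f = "\<lambda>l. ennreal (jacobi_ens_weight n a b \<beta> l)"
  define Z where "Z = (\<integral>\<^sup>+l. ?f l \<partial>?M)"
  have J: "jacobi_ensemble n a b \<beta> = density ?M (\<lambda>l. ?f l / Z)"
    unfolding jacobi_ensemble_def Z_def by (simp add: Let_def)
  have E': "E \<in> sets ?M" using E unfolding J by simp
  have "emeasure (jacobi_ensemble n a b \<beta>) E = (\<integral>\<^sup>+l. ?f l / Z * indicator E l \<partial>?M)"
    unfolding J using E' by (intro emeasure_density) auto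
  also have "\<dots> = (\<integral>\<^sup>+l. (?f l * indicator E l) * inverse Z \<partial>?M)"
    by (simp only: divide_ennreal_def ac_simps)
  also have "\<dots> = (\<integral>\<^sup>+l. ?f l * indicator E l \<partial>?M) * inverse Z"
    using E' by (intro nn_integral_multc borel_measurable_times_ennreal borel_measurable_indicator
        measurable_compose[OF jacobi_ens_weight_measurable measurable_ennreal])
  also have "\<dots> \<le> ennreal p * Z * inverse Z"
    using le unfolding Z_def by (intro mult_right_mono) auto
  also have "\<dots> = ennreal p * (Z * inverse Z)" by (simp only: mult.assoc)
  \<comment> \<open>In \<open>ennreal\<close> this also holds for \<open>Z = 0\<close> and \<open>Z = \<infinity>\<close>, so the normalisation need not be shown proper.\<close>
  also have "Z * inverse Z \<le> 1"
  proof (cases "Z = 0 \<or> Z = \<infinity>")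
    case False
    hence "Z \<noteq> 0" "Z < \<top>" by (auto simp: less_top)
    thus ?thesis using ennreal_divide_self[of Z] by (simp add: divide_ennreal_def)
  qed auto
  hence "ennreal p * (Z * inverse Z) \<le> ennreal p * 1" by (intro mult_left_mono) auto
  finally have "emeasure (jacobi_ensemble n a b \<beta>) E \<le> ennreal p" by simp
  thus ?thesis unfolding measure_def using p by (simp add: enn2real_leI)
qed

text \<open>Everything depends on \<open>K = \<kappa> * \<epsilon>\<^sup>2\<close>. For small
  \<open>K\<close> the claimed bound exceeds 1. For large \<open>K\<close> a suitable order
  \<open>k\<close>, proportional to \<open>K\<close>, makes the Markov bound decay like
  \<open>(1/2) ^ k\<close>, much faster than the target.\<close>

lemma deviation_numeric_bound:
  fixes \<kappa> \<epsilon> :: real and n :: nat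
  assumes n: "n \<ge> 2" and \<kappa>: "\<kappa> > 0" and \<epsilon>: "0 < \<epsilon>" "\<epsilon> \<le> 1"
  defines "B \<equiv> 4 * (2 * real n - 1) * exp ((ln (1 + \<epsilon>^2 / (648 + 2*\<epsilon>^2)) - \<epsilon>^2 / (648 + 2*\<epsilon>^2)) * \<kappa>)"
  shows "1 \<le> B \<or> (\<exists>k>0. 2 * (4 * real n * (16 * real (2*k+3) / \<kappa>) ^ k * (real (2*k+1) * real (2*k+2) / \<kappa>)) / \<epsilon> ^ (2*k+2) \<le> B)"
proof -
  define t where "t = \<epsilon>^2 / (648 + 2*\<epsilon>^2)"
  define K where "K = \<kappa> * \<epsilon>^2"
  have e2: "0 < \<epsilon>^2" "\<epsilon>^2 \<le> 1" using \<epsilon> by (auto simp: power_le_one)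
  have "0 \<le> t" unfolding t_def by simp
  moreover have "t \<le> \<epsilon>^2 / 648"
    unfolding t_def using e2 by (intro divide_left_mono mult_pos_pos add_pos_nonneg) auto
  ultimately have t: "0 \<le> t" "t \<le> \<epsilon>^2 / 648" "t \<le> 1" using e2 by auto
  \<comment> \<open>The target is weakened by \<open>ln (1 + t) - t \<ge> - t\<^sup>2\<close>. Here
    419904 is the square of 648, and \<open>\<epsilon>\<^sup>2 \<le> 1\<close> trades the fourth
    power of \<open>\<epsilon>\<close> for the second, so that only \<open>K\<close>
    remains.\<close>
  have "t\<^sup>2 \<le> (\<epsilon>^2 / 648)\<^sup>2" using t by (intro power_mono) auto
  also have "\<dots> = \<epsilon>^2 * \<epsilon>^2 / 419904" by (simp add: power2_eq_square)
  also have "\<dots> \<le> \<epsilon>^2 * 1 / 419904" using e2 by (intro divide_right_mono mult_left_mono) auto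
  finally have t2: "t\<^sup>2 * \<kappa> \<le> K / 419904" unfolding K_def using \<kappa> by (simp add: mult.commute)
  have "- t\<^sup>2 * \<kappa> \<le> (ln (1 + t) - t) * \<kappa>"
    using ln_one_plus_pos_lower_bound[of t] t \<kappa> by (intro mult_right_mono) auto
  hence "- (K / 419904) \<le> (ln (1 + t) - t) * \<kappa>" using t2 by simp
  \<comment> \<open>This is where \<open>n \<ge> 2\<close> enters.\<close>
  moreover have "6 * real n \<le> 4 * (2 * real n - 1)" using n by simp
  ultimately have B: "6 * real n * exp (- (K / 419904)) \<le> B"
    unfolding B_def t_def[symmetric] using n by (intro mult_mono[of "6 * real n"]) auto
  show ?thesis
  proof (cases "K < 320")
    case True
    have "1 + - (K / 419904) \<le> exp (- (K / 419904))" by (rule exp_ge_add_one_self)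
    hence "1/2 \<le> exp (- (K / 419904))" using True by simp
    hence "12 * (1/2) \<le> 6 * real n * exp (- (K / 419904))" using n by (intro mult_mono) auto
    thus ?thesis using B by simp
  next
    case False
    hence K: "K \<ge> 320" by simp
    \<comment> \<open>Chosen so that \<open>2 * k + 3 \<le> K / 64\<close>, which makes the base
      \<open>16 * (2 * k + 3) / K\<close> at most 1/4. The threshold 320 is
      \<open>128 * (1 + 3/2)\<close>, the least \<open>K\<close> for which this gives
      \<open>k \<ge> 1\<close>.\<close>
    define k where "k = nat \<lfloor>K / 128 - 3 / 2\<rfloor>"
    have k1: "real k \<le> K / 128 - 3 / 2" "K / 128 - 3 / 2 < real k + 1"
      using K unfolding k_def by linarith+
    have k0: "k > 0" using K unfolding k_def by (simp add: le_nat_iff le_floor_iff) 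
    have q: "16 * real (2*k+3) / K \<le> 1/4" using k1 K by (simp add: divide_simps)
    have r: "real (2*k+1) / K \<le> 1/64" using k1 K by (simp add: divide_simps)
    have "(16 * real (2*k+3) / \<kappa>) ^ k * (real (2*k+1) * real (2*k+2) / \<kappa>) / \<epsilon> ^ (2*k+2)
      = (16 * real (2*k+3) / K) ^ k * (real (2*k+1) / K * real (2*k+2))"
      unfolding K_def using \<kappa> \<epsilon> by (simp add: power_mult_distrib power_divide power_add power_mult power2_eq_square)
    also have "\<dots> \<le> (1/4) ^ k * (1/64 * real (2*k+2))"
      using q r K by (intro mult_mono power_mono) auto
    also have "\<dots> \<le> (1/2) ^ k / 32"
    proof -
      have "real k + 1 \<le> 2 ^ k" using less_exp[of k] by (metis Suc_leI add.commute of_nat_Suc of_nat_le_iff of_nat_numeral of_nat_power)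
      hence "(1/4) ^ k * (real k + 1) \<le> (1/4) ^ k * 2 ^ k" by (intro mult_left_mono) auto
      also have "\<dots> = (1/2::real) ^ k" by (simp add: power_mult_distrib[symmetric])
      finally have "(1/4) ^ k * (real k + 1) / 32 \<le> (1/2::real) ^ k / 32" by (rule divide_right_mono) simp
      moreover have "(1/4) ^ k * (1/64 * real (2*k+2)) = (1/4) ^ k * (real k + 1) / 32"
        by (simp add: algebra_simps)
      ultimately show ?thesis by (simp only:)
    qed
    finally have 1: "(16 * real (2*k+3) / \<kappa>) ^ k * (real (2*k+1) * real (2*k+2) / \<kappa>) / \<epsilon> ^ (2*k+2) \<le> (1/2) ^ k / 32" .
    have "2 * (4 * real n * (16 * real (2*k+3) / \<kappa>) ^ k * (real (2*k+1) * real (2*k+2) / \<kappa>)) / \<epsilon> ^ (2*k+2)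
      = 8 * real n * ((16 * real (2*k+3) / \<kappa>) ^ k * (real (2*k+1) * real (2*k+2) / \<kappa>) / \<epsilon> ^ (2*k+2))" by simp
    also have "\<dots> \<le> 8 * real n * ((1/2) ^ k / 32)" using 1 by (intro mult_left_mono) auto
    also have "\<dots> \<le> 6 * real n * (1/2) ^ k" by simp
    also have "(1/2::real) ^ k \<le> exp (- (real k / 2))"
    proof -
      have "exp (1/2) ^ k \<le> (2::real) ^ k" using exp_half_le2 by (intro power_mono) auto
      hence "exp (real k / 2) \<le> 2 ^ k" by (simp add: exp_of_nat_mult[symmetric])
      thus ?thesis by (simp add: exp_minus power_divide field_simps)
    qed
    \<comment> \<open>Rounding down gives \<open>K < 128 * (k + 5/2)\<close>, and
      \<open>k \<ge> 1\<close> turns this into \<open>K < 448 * k\<close>, far less than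
      needed.\<close>
    also have "exp (- (real k / 2)) \<le> exp (- (K / 419904))" using k1 k0 by simp
    finally have "2 * (4 * real n * (16 * real (2*k+3) / \<kappa>) ^ k * (real (2*k+1) * real (2*k+2) / \<kappa>)) / \<epsilon> ^ (2*k+2)
      \<le> 6 * real n * exp (- (K / 419904))" by (simp add: mult_left_mono)
    thus ?thesis using B k0 by (meson order_trans)
  qed
qed

theorem theorem2p1:
  fixes n :: nat and a b \<beta> \<epsilon> :: real
  assumes "n \<ge> 2" and "a > -1" and "b > -1" and "\<beta> > 0"
    and "0 < \<epsilon>" and "\<epsilon> \<le> 1"
  shows "measure (jacobi_ensemble n a b \<beta>)
      {l \<in> space (jacobi_ensemble n a b \<beta>).
         Max ((\<lambda>j. \<bar>order_stat n l j
                   - jacobi_scaled_roots ((2*a+2)/\<beta> - 1) ((2*b+2)/\<beta> - 1) n ! j\<bar>) ` {..<n}) > \<epsilon>}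
    \<le> 4 * (2 * real n - 1) *
       exp ((ln (1 + \<epsilon>^2 / (648 + 2*\<epsilon>^2)) - \<epsilon>^2 / (648 + 2*\<epsilon>^2)) * (a + b + 2))"
    (is "measure ?\<mu> ?E \<le> ?B")
proof -
  define xs where "xs = jacobi_scaled_roots ((2*a+2)/\<beta> - 1) ((2*b+2)/\<beta> - 1) n"
  define x where "x = (\<lambda>j. xs ! j)"
  have gd: "(2*a+2)/\<beta> - 1 > -1" "(2*b+2)/\<beta> - 1 > -1" using assms by auto
  note roots = jacobi_scaled_roots_stieltjes[OF gd, where n = n, folded xs_def]
  have x_mono: "x i < x j" if "i < j" "j < n" for i j
    unfolding x_def using sorted_wrt_nth_less[OF roots(2)] that roots(1) by auto
  have xb: "\<bar>x i\<bar> < 2" if "i < n" for i unfolding x_def by (rule roots(3)[OF that])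
  \<comment> \<open>The Jacobi parameters are chosen so that multiplying Stieltjes' equations by
    \<open>\<beta> / 2\<close> turns their numerators \<open>(2*a+2)/\<beta>\<close> and
    \<open>(2*b+2)/\<beta>\<close> into \<open>a + 1\<close> and \<open>b + 1\<close>.\<close>
  have eq: "equilibrium {..<n} \<beta> (a+1) (b+1) x"
    unfolding equilibrium_def
  proof (intro ballI conjI)
    fix i assume "i \<in> {..<n}"
    hence i: "i < n" by simp
    show "\<bar>x i\<bar> < 2" by (rule xb[OF i])
    have "\<beta> * (\<Sum>j\<in>{..<n}-{i}. 1 / (x i - x j)) = \<beta> / 2 * (2 * (\<Sum>j\<in>{..<n}-{i}. 1 / (x i - x j)))" by simp
    also have "2 * (\<Sum>j\<in>{..<n}-{i}. 1 / (x i - x j)) = (2*a+2)/\<beta> / (2 - x i) - (2*b+2)/\<beta> / (2 + x i)"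
      using roots(4)[OF i] unfolding x_def by simp
    also have "\<beta> / 2 * \<dots> = (a+1) / (2 - x i) - (b+1) / (2 + x i)"
    proof -
      have "\<beta> / 2 * ((2 * p + 2) / \<beta> / u) = (p + 1) / u" for p u
        using assms(4) by (cases "u = 0") (simp_all add: divide_simps)
      thus ?thesis by (simp only: right_diff_distrib)
    qed
    finally show "\<beta> * (\<Sum>j\<in>{..<n}-{i}. 1 / (x i - x j)) = (a+1) / (2 - x i) - (b+1) / (2 + x i)" .
  qed
  let ?M = "PiM {..<n} (\<lambda>_. lborel :: real measure)"
  let ?f = "jacobi_ens_weight n a b \<beta>"
  have B0: "?B \<ge> 0" using assms by auto
  have int_f: "integrable ?M ?f" by (rule jacobi_ens_weight_integrable[OF assms(2-4)])
  have Z: "(\<integral>\<^sup>+l. ennreal (?f l) \<partial>?M) = ennreal (integral\<^sup>L ?M ?f)"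
    by (intro nn_integral_eq_integral int_f AE_I2 jacobi_ens_weight_nonneg)
  have Z0: "integral\<^sup>L ?M ?f \<ge> 0" by (intro Bochner_Integration.integral_nonneg jacobi_ens_weight_nonneg)
  show ?thesis
  proof (cases "?E \<in> sets ?\<mu>")
    \<comment> \<open>\<open>measure\<close> is 0 by convention on a set outside
      \<open>sets\<close>, so this case is immediate from the nonnegative right-hand side.\<close>
    case False
    thus ?thesis using B0 by (simp add: measure_notin_sets)
  next
    case E: True
    have "1 \<le> ?B \<or> (\<exists>k>0. 2 * (4 * real n * (16 * real (2*k+3) / (a+b+2)) ^ k * (real (2*k+1) * real (2*k+2) / (a+b+2))) / \<epsilon> ^ (2*k+2) \<le> ?B)"
      using assms by (intro deviation_numeric_bound) auto
    thus ?thesis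
    proof
      assume B: "1 \<le> ?B"
      have "measure ?\<mu> ?E \<le> 1"
        by (rule emeasure_jacobi_ensemble_le[OF E]) (auto intro!: nn_integral_mono simp: indicator_def)
      thus ?thesis using B by linarith
    next
      assume "\<exists>k>0. 2 * (4 * real n * (16 * real (2*k+3) / (a+b+2)) ^ k * (real (2*k+1) * real (2*k+2) / (a+b+2))) / \<epsilon> ^ (2*k+2) \<le> ?B"
      then obtain k where k: "k > 0" and 
        B: "2 * (4 * real n * (16 * real (2*k+3) / (a+b+2)) ^ k * (real (2*k+1) * real (2*k+2) / (a+b+2))) / \<epsilon> ^ (2*k+2) \<le> ?B"
        by blast
      define P where "P = 4 * real n * (16 * real (2*k+3) / (a+b+2)) ^ k * (real (2*k+1) * real (2*k+2) / (a+b+2))"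
      define Y where "Y = (\<lambda>s l i. max (s * (l i - x (rank_of n l i))) 0 ^ (2*k+2))"
      define S where "S = (\<lambda>s l. \<Sum>i<n. Y s l i)"
      have Y0: "Y s l i \<ge> 0" for s l i unfolding Y_def by simp
      have S_ge: "Y s l i \<le> S s l" if "i < n" for s l i
        unfolding S_def using that Y0 by (intro member_le_sum) auto
      have S0: "S s l \<ge> 0" for s l unfolding S_def using Y0 by (intro sum_nonneg) auto
      have int: "integrable ?M (\<lambda>l. ?f l * S s l)" if "s = 1 \<or> s = -1" for s
        unfolding S_def Y_def by (intro deviation_moment_integrable assms that xb)
      have mom: "integral\<^sup>L ?M (\<lambda>l. ?f l * S s l) \<le> P * integral\<^sup>L ?M ?f" if "s = 1 \<or> s = -1" for s
        unfolding S_def Y_def P_def by (intro deviation_moment_le k that assms eq x_mono)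
      \<comment> \<open>Markov's inequality before integration: on the event, the particle with the
        offending rank contributes at least \<open>\<epsilon> ^ (2*k+2)\<close> to one of the two
        one-sided sums. Using both sums costs the factor 2 in the numerical bound.\<close>
      have point: "?f l * indicator ?E l \<le> (?f l * S 1 l + ?f l * S (-1) l) / \<epsilon> ^ (2*k+2)" for l
      proof (cases "?f l = 0 \<or> l \<notin> ?E")
        case True
        have "0 \<le> (?f l * S 1 l + ?f l * S (-1) l) / \<epsilon> ^ (2*k+2)"
          using S0 jacobi_ens_weight_nonneg[of n a b \<beta> l] assms(5) by (intro divide_nonneg_nonneg add_nonneg_nonneg mult_nonneg_nonneg) auto
        thus ?thesis using True by auto
      next
        case False
        hence f: "?f l \<noteq> 0" and l: "l \<in> ?E" by auto
        note pos = jacobi_ens_weight_pos_imp[OF f]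
        have "\<epsilon> < Max ((\<lambda>j. \<bar>order_stat n l j - x j\<bar>) ` {..<n})"
          using l unfolding x_def xs_def by simp
        moreover have "(\<lambda>j. \<bar>order_stat n l j - x j\<bar>) ` {..<n} \<noteq> {}" using assms(1) by (simp add: lessThan_empty_iff)
        ultimately obtain j where j: "j < n" "\<epsilon> < \<bar>order_stat n l j - x j\<bar>"
          by (subst (asm) Max_gr_iff) auto
        obtain i where i: "i < n" "rank_of n l i = j" "order_stat n l j = l i"
          by (rule order_stat_rank[OF pos(1) j(1)])
        have "\<epsilon> ^ (2*k+2) \<le> S 1 l + S (-1) l"
        proof (cases "l i - x j > \<epsilon>")
          case True
          hence "\<epsilon> ^ (2*k+2) \<le> Y 1 l i" unfolding Y_def i(2) using assms(5) by (intro power_mono) auto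
          thus ?thesis using S_ge[OF i(1), of 1 l] S0[of "-1" l] by linarith
        next
          case False
          hence "x j - l i > \<epsilon>" using j i by linarith
          hence "\<epsilon> ^ (2*k+2) \<le> Y (-1) l i" unfolding Y_def i(2) using assms(5) by (intro power_mono) auto
          thus ?thesis using S_ge[OF i(1), of "-1" l] S0[of "1" l] by linarith
        qed
        hence "1 \<le> (S 1 l + S (-1) l) / \<epsilon> ^ (2*k+2)" using assms(5) by simp
        hence "?f l * 1 \<le> ?f l * ((S 1 l + S (-1) l) / \<epsilon> ^ (2*k+2))"
          by (intro mult_left_mono jacobi_ens_weight_nonneg)
        thus ?thesis using l by (simp add: algebra_simps)
      qed
      have "(\<integral>\<^sup>+l. ennreal (?f l) * indicator ?E l \<partial>?M) \<le> (\<integral>\<^sup>+l. ennreal ((?f l * S 1 l + ?f l * S (-1) l) / \<epsilon> ^ (2*k+2)) \<partial>?M)"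
      proof (rule nn_integral_mono)
        fix l
        have "ennreal (?f l) * indicator ?E l = ennreal (?f l * indicator ?E l)"
          by (auto simp: indicator_def)
        also have "\<dots> \<le> ennreal ((?f l * S 1 l + ?f l * S (-1) l) / \<epsilon> ^ (2*k+2))"
          by (intro ennreal_leI point)
        finally show "ennreal (?f l) * indicator ?E l \<le> ennreal ((?f l * S 1 l + ?f l * S (-1) l) / \<epsilon> ^ (2*k+2))" .
      qed
      also have "\<dots> = ennreal (integral\<^sup>L ?M (\<lambda>l. (?f l * S 1 l + ?f l * S (-1) l) / \<epsilon> ^ (2*k+2)))"
      proof (rule nn_integral_eq_integral)
        show "integrable ?M (\<lambda>l. (?f l * S 1 l + ?f l * S (-1) l) / \<epsilon> ^ (2*k+2))"
          by (intro integrable_divide Bochner_Integration.integrable_add int) auto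
        show "AE l in ?M. 0 \<le> (?f l * S 1 l + ?f l * S (-1) l) / \<epsilon> ^ (2*k+2)"
          using S0 assms(5) by (intro AE_I2 divide_nonneg_nonneg add_nonneg_nonneg mult_nonneg_nonneg jacobi_ens_weight_nonneg) auto
      qed
      also have "integral\<^sup>L ?M (\<lambda>l. (?f l * S 1 l + ?f l * S (-1) l) / \<epsilon> ^ (2*k+2)) = 
         (integral\<^sup>L ?M (\<lambda>l. ?f l * S 1 l) + integral\<^sup>L ?M (\<lambda>l. ?f l * S (-1) l)) / \<epsilon> ^ (2*k+2)"
        using int[of 1] int[of "-1"] by simp
      also have "\<dots> \<le> (P * integral\<^sup>L ?M ?f + P * integral\<^sup>L ?M ?f) / \<epsilon> ^ (2*k+2)"
        using assms(5) by (intro divide_right_mono add_mono mom) auto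
      also have "\<dots> = 2 * P / \<epsilon> ^ (2*k+2) * integral\<^sup>L ?M ?f" by simp
      also have "\<dots> \<le> ?B * integral\<^sup>L ?M ?f"
        using B Z0 unfolding P_def[symmetric] by (rule mult_right_mono)
      also have "ennreal (?B * integral\<^sup>L ?M ?f) = ennreal ?B * (\<integral>\<^sup>+l. ennreal (?f l) \<partial>?M)"
        unfolding Z using B0 Z0 by (rule ennreal_mult)
      finally show ?thesis by (intro emeasure_jacobi_ensemble_le[OF E B0]) (auto intro: ennreal_leI)
    qed
  qed
qed

end
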